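(* Let $d\geq 2$ be an integer. Then the Cuntz algebra $\mathcal{O}_d$ is generated (as a $\mathrm{C}^*$-algebra) by a single contraction for which the closed unit disc $\overline{\mathbb{D}}$ is a minimal spectral set.
   Context: The Cuntz algebra $\mathcal{O}_d$ is the universal $\mathrm{C}^*$-algebra generated by isometries $s_1,\dots,s_d$ satisfying $\sum_{j=1}^d s_js_j^*=1$. An element $T$ of a unital $\mathrm{C}^*$-algebra is viewed as an operator via a faithful unital representation. A compact set $X\subset\mathbb{C}$ containing $\sigma(T)$ is a spectral set for $T$ if $\|r(T)\|\le\sup_X|r|$ for every rational function $r$ with poles outside of $X$. A spectral set is minimal if no proper closed subset of it is a spectral set for $T$. *)

theory Defs
  imports
    "HOL-Analysis.Analysis"
    "HOL-Computational_Algebra.Polynomial"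
    "HOL-Algebra.Ring"
begin

section \<open>Unital C*-algebras as a type class\<close>

text \<open>Inherited from \<^class>\<open>real_normed_algebra_1\<close> and \<^class>\<open>banach\<close>: a nonzero unital ring with a
  complete submultiplicative norm.\<close>

class cstar_algebra = real_normed_algebra_1 + banach +
  fixes scaleC :: "complex \<Rightarrow> 'a \<Rightarrow> 'a" (infixr \<open>*\<^sub>C\<close> 75)
    and adj :: "'a \<Rightarrow> 'a"
  assumes scaleC_add_right: "a *\<^sub>C (x + y) = a *\<^sub>C x + a *\<^sub>C y"
    and scaleC_add_left: "(a + b) *\<^sub>C x = a *\<^sub>C x + b *\<^sub>C x"
    and scaleC_scaleC: "a *\<^sub>C (b *\<^sub>C x) = (a * b) *\<^sub>C x"
    and scaleC_one: "1 *\<^sub>C x = x"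
    and scaleR_scaleC: "r *\<^sub>R x = complex_of_real r *\<^sub>C x"
    and mult_scaleC_left: "(a *\<^sub>C x) * y = a *\<^sub>C (x * y)"
    and mult_scaleC_right: "x * (a *\<^sub>C y) = a *\<^sub>C (x * y)"
    and norm_scaleC: "norm (a *\<^sub>C x) = cmod a * norm x"
    and adj_adj: "adj (adj x) = x"
    and adj_add: "adj (x + y) = adj x + adj y"
    and adj_scaleC: "adj (a *\<^sub>C x) = cnj a *\<^sub>C adj x"
    and adj_mult: "adj (x * y) = adj y * adj x"
    and cstar_identity: "norm (adj x * x) = (norm x)\<^sup>2"

text \<open>C*-subalgebras are not required to contain the unit, so ``generated'' below is meant in the
  sense of not necessarily unital C*-algebras.\<close>

definition cstar_subalgebra :: "'a::cstar_algebra set \<Rightarrow> bool" where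
  "cstar_subalgebra S \<longleftrightarrow>
     closed S \<and> 0 \<in> S \<and>
     (\<forall>x\<in>S. \<forall>y\<in>S. x + y \<in> S) \<and>
     (\<forall>a. \<forall>x\<in>S. a *\<^sub>C x \<in> S) \<and>
     (\<forall>x\<in>S. \<forall>y\<in>S. x * y \<in> S) \<and>
     (\<forall>x\<in>S. adj x \<in> S)"

abbreviation cstar_generated :: "'a::cstar_algebra set \<Rightarrow> 'a set" where
  "cstar_generated G \<equiv> cstar_subalgebra hull G"


section \<open>Spectral sets\<close>

definition alg_invertible :: "'a::cstar_algebra \<Rightarrow> bool" where
  "alg_invertible x \<longleftrightarrow> (\<exists>y. x * y = 1 \<and> y * x = 1)"

definition alg_inverse :: "'a::cstar_algebra \<Rightarrow> 'a" where
  "alg_inverse x = (THE y. x * y = 1 \<and> y * x = 1)"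

definition spectrum :: "'a::cstar_algebra \<Rightarrow> complex set" where
  "spectrum T = {l. \<not> alg_invertible (l *\<^sub>C 1 - T)}"

definition poly_at :: "complex poly \<Rightarrow> 'a::cstar_algebra \<Rightarrow> 'a" where
  "poly_at p T = (\<Sum>i\<le>degree p. coeff p i *\<^sub>C T ^ i)"

text \<open>Rational functions with poles outside \<open>X\<close> are the quotients \<open>p / q\<close> of polynomials for which
  \<open>q\<close> has no zero on \<open>X\<close>; as \<open>spectrum T \<subseteq> X\<close>, the element \<open>q(T)\<close> is then invertible.  Norm, spectrum
  and inverse of an element do not change under a faithful unital representation, so they are taken
  in the algebra itself.\<close>

definition spectral_set :: "complex set \<Rightarrow> 'a::cstar_algebra \<Rightarrow> bool" where
  "spectral_set X T \<longleftrightarrow>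
     compact X \<and> spectrum T \<subseteq> X \<and>
     (\<forall>p q. (\<forall>z\<in>X. poly q z \<noteq> 0) \<longrightarrow>
        norm (poly_at p T * alg_inverse (poly_at q T)) \<le> (SUP z\<in>X. cmod (poly p z / poly q z)))"

definition minimal_spectral_set :: "complex set \<Rightarrow> 'a::cstar_algebra \<Rightarrow> bool" where
  "minimal_spectral_set X T \<longleftrightarrow>
     spectral_set X T \<and> (\<forall>Y. closed Y \<and> Y \<subset> X \<longrightarrow> \<not> spectral_set Y T)"


section \<open>Unital C*-algebras as structures on a carrier\<close>

text \<open>The universal property of the Cuntz algebra quantifies over C*-algebras, which is not possible
  inside a formula if they are types.  Hence the second, carrier based, form of the same notion.\<close>

record 'b cstar_struct = "'b ring" +
  str_scale :: "complex \<Rightarrow> 'b \<Rightarrow> 'b"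
  str_adj :: "'b \<Rightarrow> 'b"
  str_norm :: "'b \<Rightarrow> real"

locale unital_cstar_struct = ring B for B :: "'b cstar_struct" (structure) +
  assumes str_scale_closed: "x \<in> carrier B \<Longrightarrow> str_scale B a x \<in> carrier B"
    and str_scale_add_right: "\<lbrakk>x \<in> carrier B; y \<in> carrier B\<rbrakk> \<Longrightarrow>
      str_scale B a (x \<oplus> y) = str_scale B a x \<oplus> str_scale B a y"
    and str_scale_add_left: "x \<in> carrier B \<Longrightarrow>
      str_scale B (a + b) x = str_scale B a x \<oplus> str_scale B b x"
    and str_scale_scale: "x \<in> carrier B \<Longrightarrow> str_scale B a (str_scale B b x) = str_scale B (a * b) x"
    and str_scale_one: "x \<in> carrier B \<Longrightarrow> str_scale B 1 x = x"
    and str_mult_scale_left: "\<lbrakk>x \<in> carrier B; y \<in> carrier B\<rbrakk> \<Longrightarrow>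
      str_scale B a x \<otimes> y = str_scale B a (x \<otimes> y)"
    and str_mult_scale_right: "\<lbrakk>x \<in> carrier B; y \<in> carrier B\<rbrakk> \<Longrightarrow>
      x \<otimes> str_scale B a y = str_scale B a (x \<otimes> y)"
    and str_norm_nonneg: "x \<in> carrier B \<Longrightarrow> 0 \<le> str_norm B x"
    and str_norm_eq_0: "x \<in> carrier B \<Longrightarrow> str_norm B x = 0 \<longleftrightarrow> x = \<zero>"
    and str_norm_triangle: "\<lbrakk>x \<in> carrier B; y \<in> carrier B\<rbrakk> \<Longrightarrow>
      str_norm B (x \<oplus> y) \<le> str_norm B x + str_norm B y"
    and str_norm_scale: "x \<in> carrier B \<Longrightarrow> str_norm B (str_scale B a x) = cmod a * str_norm B x"
    and str_norm_mult: "\<lbrakk>x \<in> carrier B; y \<in> carrier B\<rbrakk> \<Longrightarrow>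
      str_norm B (x \<otimes> y) \<le> str_norm B x * str_norm B y"
    and str_complete: "Metric_space.mcomplete (carrier B) (\<lambda>x y. str_norm B (x \<ominus> y))"
    and str_adj_closed: "x \<in> carrier B \<Longrightarrow> str_adj B x \<in> carrier B"
    and str_adj_adj: "x \<in> carrier B \<Longrightarrow> str_adj B (str_adj B x) = x"
    and str_adj_add: "\<lbrakk>x \<in> carrier B; y \<in> carrier B\<rbrakk> \<Longrightarrow>
      str_adj B (x \<oplus> y) = str_adj B x \<oplus> str_adj B y"
    and str_adj_scale: "x \<in> carrier B \<Longrightarrow> str_adj B (str_scale B a x) = str_scale B (cnj a) (str_adj B x)"
    and str_adj_mult: "\<lbrakk>x \<in> carrier B; y \<in> carrier B\<rbrakk> \<Longrightarrow>
      str_adj B (x \<otimes> y) = str_adj B y \<otimes> str_adj B x"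
    and str_cstar_identity: "x \<in> carrier B \<Longrightarrow> str_norm B (str_adj B x \<otimes> x) = (str_norm B x)\<^sup>2"

definition type_cstar :: "'a::cstar_algebra cstar_struct" where
  "type_cstar = \<lparr>carrier = UNIV, monoid.mult = (*), one = 1, zero = 0, add = (+),
     str_scale = scaleC, str_adj = adj, str_norm = norm\<rparr>"

lemma type_cstar_simps [simp]:
  "carrier type_cstar = UNIV"
  "x \<otimes>\<^bsub>type_cstar\<^esub> y = x * y"
  "\<one>\<^bsub>type_cstar\<^esub> = 1"
  "\<zero>\<^bsub>type_cstar\<^esub> = 0"
  "x \<oplus>\<^bsub>type_cstar\<^esub> y = x + y"
  "str_scale type_cstar = scaleC"
  "str_adj type_cstar = adj"
  "str_norm type_cstar = norm"
  by (simp_all add: type_cstar_def)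

lemma ring_type_cstar: "ring (type_cstar :: 'a::cstar_algebra cstar_struct)"
proof (rule ringI)
  show "abelian_group (type_cstar :: 'a cstar_struct)"
    by (rule abelian_groupI) (auto simp: algebra_simps intro: exI[of _ "- _"])
  show "monoid (type_cstar :: 'a cstar_struct)"
    by (rule monoidI) (auto simp: algebra_simps)
qed (auto simp: algebra_simps)

lemma finsum_type_cstar:
  fixes f :: "'i \<Rightarrow> 'a::cstar_algebra"
  assumes "finite I"
  shows "finsum type_cstar f I = sum f I"
proof -
  interpret ring "type_cstar :: 'a cstar_struct" by (rule ring_type_cstar)
  show ?thesis using assms by induction simp_all
qed

lemma unital_cstar_struct_type_cstar: "unital_cstar_struct (type_cstar :: 'a::cstar_algebra cstar_struct)"
proof -
  interpret ring "type_cstar :: 'a cstar_struct" by (rule ring_type_cstar)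
  have uminus: "\<ominus>\<^bsub>type_cstar\<^esub> x = - x" for x :: 'a
    by (rule minus_equality) auto
  have "(\<lambda>x y :: 'a. norm (x \<ominus>\<^bsub>type_cstar\<^esub> y)) = dist"
    by (auto simp: a_minus_def uminus dist_norm fun_eq_iff)
  moreover have "Metric_space.mcomplete (UNIV :: 'a set) dist"
    using complete_UNIV by (simp add: mcomplete_iff_complete)
  ultimately show ?thesis
    by unfold_locales
      (auto simp: scaleC_add_right scaleC_add_left scaleC_scaleC scaleC_one mult_scaleC_left
        mult_scaleC_right norm_scaleC adj_adj adj_add adj_scaleC adj_mult cstar_identity
        norm_triangle_ineq norm_mult_ineq)
qed


section \<open>The Cuntz algebra\<close>

definition unital_star_hom :: "'a cstar_struct \<Rightarrow> 'b cstar_struct \<Rightarrow> ('a \<Rightarrow> 'b) \<Rightarrow> bool" where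
  "unital_star_hom A B h \<longleftrightarrow>
     h \<in> carrier A \<rightarrow> carrier B \<and>
     (\<forall>x\<in>carrier A. \<forall>y\<in>carrier A. h (x \<oplus>\<^bsub>A\<^esub> y) = h x \<oplus>\<^bsub>B\<^esub> h y) \<and>
     (\<forall>a. \<forall>x\<in>carrier A. h (str_scale A a x) = str_scale B a (h x)) \<and>
     (\<forall>x\<in>carrier A. \<forall>y\<in>carrier A. h (x \<otimes>\<^bsub>A\<^esub> y) = h x \<otimes>\<^bsub>B\<^esub> h y) \<and>
     (\<forall>x\<in>carrier A. h (str_adj A x) = str_adj B (h x)) \<and>
     h \<one>\<^bsub>A\<^esub> = \<one>\<^bsub>B\<^esub>"

definition cuntz_family :: "'b cstar_struct \<Rightarrow> nat \<Rightarrow> (nat \<Rightarrow> 'b) \<Rightarrow> bool" where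
  "cuntz_family B d t \<longleftrightarrow>
     (\<forall>j<d. t j \<in> carrier B \<and> str_adj B (t j) \<otimes>\<^bsub>B\<^esub> t j = \<one>\<^bsub>B\<^esub>) \<and>
     (\<Oplus>\<^bsub>B\<^esub>j\<in>{..<d}. t j \<otimes>\<^bsub>B\<^esub> str_adj B (t j)) = \<one>\<^bsub>B\<^esub>"

lemma cuntz_family_type_cstar:
  "cuntz_family type_cstar d s \<longleftrightarrow>
     (\<forall>j<d. adj (s j) * s j = 1) \<and> (\<Sum>j<d. s j * adj (s j)) = 1"
  by (simp add: cuntz_family_def finsum_type_cstar)

text \<open>\<open>is_cuntz_algebra d s\<close>: the C*-algebra given by the type of \<open>s 0, \<dots>, s (d - 1)\<close> is the universal
  C*-algebra generated by isometries \<open>s j\<close> whose range projections sum to the unit.  It suffices to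
  test the universal property on C*-algebras whose carrier consists of real numbers: a C*-algebra
  generated by finitely many elements is separable, hence has at most the cardinality of the
  continuum and is isomorphic to one of this form, and the image of the universal homomorphism lies
  in the C*-subalgebra generated by the \<open>t j\<close>.  Uniqueness of the homomorphism is a
  consequence of generation, as *-homomorphisms are continuous.\<close>

definition is_cuntz_algebra :: "nat \<Rightarrow> (nat \<Rightarrow> 'a::cstar_algebra) \<Rightarrow> bool" where
  "is_cuntz_algebra d s \<longleftrightarrow>
     cuntz_family type_cstar d s \<and>
     cstar_generated (s ` {..<d}) = UNIV \<and>
     (\<forall>(B :: real cstar_struct) t. unital_cstar_struct B \<and> cuntz_family B d t \<longrightarrow>
        (\<exists>h. unital_star_hom type_cstar B h \<and> (\<forall>j<d. h (s j) = t j)))"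

end

theory Submission
  imports
    Defs
    "HOL-Complex_Analysis.Complex_Analysis"
    "HOL-Real_Asymp.Real_Asymp"
    "HOL-Computational_Algebra.Fundamental_Theorem_Algebra"
begin

text \<open>The generator cannot be found by asking for the closed disc as its spectrum, which would make
  minimality automatic: a contraction with a spectral value of modulus 1 gives a character of the
  C*-algebra that it generates, and \<open>O\<^sub>d\<close> has no characters.  Minimality is instead forced by a Jordan
  block of norm one.  If \<open>T x = y\<close> and \<open>T y = 0\<close> for isometries \<open>x\<close>, \<open>y\<close>, then \<open>r(T) x = r'(0) y\<close> whenever
  \<open>r(0) = 0\<close>, so on a spectral set \<open>Y\<close> for \<open>T\<close> the Schwarz lemma \<open>\<bar>r'(0)\<bar> \<le> sup \<bar>r\<bar>\<close> has to hold.  It fails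
  on every proper closed subset of the disc (\<open>Schwarz_lemma_fails\<close>, \<open>minimal_spectral_set_disc\<close>).

  The \<open>d\<^sup>2\<close> words \<open>m\<^sub>n\<close> of length two in the generators \<open>s\<^sub>j\<close> are isometries whose range projections sum to
  1, so that elements of \<open>O\<^sub>d\<close> are matrices over \<open>O\<^sub>d\<close> with \<open>d\<^sup>2\<close> rows and columns.  As \<open>d\<^sup>2 \<ge> d + 2\<close>, there
  is room in such a matrix for the Jordan block in the first two columns, for a superdiagonal that
  produces all matrix units, and for \<open>s\<^sub>0, \<dots>, s\<^sub>d\<^sub>-\<^sub>1\<close> in the last row.  Hence it generates \<open>O\<^sub>d\<close>
  (\<open>matrix_letter_in_generated\<close>).

  That the disc is a spectral set is von Neumann's inequality.  For an isometry \<open>V\<close> it follows from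
  the hyponormality of polynomials in \<open>V\<close> (\<open>von_neumann_isometry\<close>).  The chosen matrix has orthogonal
  columns, therefore \<open>1 - T\<^sup>* T\<close> is diagonal with an explicit square root, and an isometric dilation of
  \<open>T\<close> can be written down in \<open>O\<^sub>d\<close> itself (\<open>von_neumann_defect\<close>).  Approximating \<open>1 / q\<close> by polynomials
  extends the inequality to rational functions (\<open>spectral_set_disc\<close>).

  The defining relations of \<open>O\<^sub>d\<close> do not mention that the ranges of the \<open>s\<^sub>j\<close> are orthogonal.  This is
  obtained from the elementary positivity argument in \<open>self_adjoint_eq_0I\<close>.\<close>


section \<open>Elementary identities in C*-algebras\<close>

lemma scaleC_0_left [simp]: "0 *\<^sub>C (x :: 'a::cstar_algebra) = 0"
  using scaleC_add_left[of 0 0 x] by simp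

lemma scaleC_0_right [simp]: "a *\<^sub>C (0 :: 'a::cstar_algebra) = 0"
  using scaleC_add_right[of a 0 "0 :: 'a"] by simp

lemma scaleC_minus_left: "(- a) *\<^sub>C (x :: 'a::cstar_algebra) = - (a *\<^sub>C x)"
  by (rule minus_unique[symmetric]) (simp flip: scaleC_add_left)

lemma scaleC_minus_right: "a *\<^sub>C (- x :: 'a::cstar_algebra) = - (a *\<^sub>C x)"
  by (rule minus_unique[symmetric]) (simp flip: scaleC_add_right)

lemma scaleC_sum_right: "a *\<^sub>C (\<Sum>i\<in>I. f i :: 'a::cstar_algebra) = (\<Sum>i\<in>I. a *\<^sub>C f i)"
  by (induction I rule: infinite_finite_induct) (simp_all add: scaleC_add_right)

lemma adj_0 [simp]: "adj (0 :: 'a::cstar_algebra) = 0"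
  using adj_add[of 0 "0 :: 'a"] by simp

lemma adj_1 [simp]: "adj (1 :: 'a::cstar_algebra) = 1"
  using adj_mult[of "adj (1 :: 'a)" 1] by (simp add: adj_adj)

lemma adj_minus: "adj (- x :: 'a::cstar_algebra) = - adj x"
  by (rule minus_unique[symmetric]) (simp flip: adj_add)

lemma adj_diff: "adj (x - y :: 'a::cstar_algebra) = adj x - adj y"
  using adj_add[of x "- y"] by (simp add: adj_minus)

lemma adj_sum: "adj (\<Sum>i\<in>I. f i :: 'a::cstar_algebra) = (\<Sum>i\<in>I. adj (f i))"
  by (induction I rule: infinite_finite_induct) (simp_all add: adj_add)

lemma adj_scaleR: "adj (r *\<^sub>R x :: 'a::cstar_algebra) = r *\<^sub>R adj x"
  by (simp add: scaleR_scaleC adj_scaleC)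

lemma adj_power: "adj (x ^ n :: 'a::cstar_algebra) = adj x ^ n"
  by (induction n) (simp_all add: adj_mult power_commutes)

lemma norm_adj [simp]: "norm (adj x :: 'a::cstar_algebra) = norm x"
proof -
  have le: "norm z \<le> norm (adj z)" for z :: 'a
  proof (cases "z = 0")
    case False
    have "norm z * norm z \<le> norm (adj z) * norm z"
      using norm_mult_ineq[of "adj z" z] by (simp add: cstar_identity power2_eq_square)
    with False show ?thesis by simp
  qed simp
  from le[of x] le[of "adj x"] show ?thesis by (simp add: adj_adj)
qed

lemma norm_eq_of_square_eq:
  fixes x y :: "'a::cstar_algebra"
  assumes "adj x * x = adj y * y"
  shows "norm x = norm y"
  using assms by (metis cstar_identity norm_ge_zero power2_eq_iff_nonneg)

lemma norm_isometry_mult: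
  fixes v z :: "'a::cstar_algebra"
  assumes "adj v * v = 1"
  shows "norm (v * z) = norm z"
proof (rule norm_eq_of_square_eq)
  have "adj (v * z) * (v * z) = adj z * (adj v * v) * z"
    by (simp add: adj_mult mult.assoc)
  with assms show "adj (v * z) * (v * z) = adj z * z" by simp
qed

lemma norm_isometry:
  fixes v :: "'a::cstar_algebra"
  assumes "adj v * v = 1"
  shows "norm v = 1"
  using norm_isometry_mult[OF assms, of 1] by simp

lemma isometry_power:
  fixes v :: "'a::cstar_algebra"
  assumes "adj v * v = 1"
  shows "adj v ^ n * v ^ n = 1"
proof (induction n)
  case (Suc n)
  have "adj v ^ Suc n * v ^ Suc n = adj v ^ n * (adj v * v) * v ^ n"
    by (simp add: power_Suc2 mult.assoc del: power_Suc)
      (simp add: mult.assoc power_commutes)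
  with assms Suc show ?case by simp
qed simp


section \<open>Polynomial calculus\<close>

lemma poly_at_eq_sum:
  assumes "degree p \<le> n"
  shows "poly_at p (T :: 'a::cstar_algebra) = (\<Sum>i\<le>n. coeff p i *\<^sub>C T ^ i)"
  unfolding poly_at_def using assms
  by (intro sum.mono_neutral_left) (auto simp: coeff_eq_0)

lemma poly_at_0 [simp]: "poly_at 0 (T :: 'a::cstar_algebra) = 0"
  by (simp add: poly_at_def)

lemma poly_at_pCons: "poly_at (pCons a p) (T :: 'a::cstar_algebra) = a *\<^sub>C 1 + T * poly_at p T"
proof -
  have "poly_at (pCons a p) T = (\<Sum>i\<le>Suc (degree p). coeff (pCons a p) i *\<^sub>C T ^ i)"
    by (rule poly_at_eq_sum) (simp add: degree_pCons_le)
  also have "\<dots> = a *\<^sub>C 1 + (\<Sum>i\<le>degree p. coeff p i *\<^sub>C T ^ Suc i)"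
    by (subst sum.atMost_Suc_shift) simp
  also have "(\<Sum>i\<le>degree p. coeff p i *\<^sub>C T ^ Suc i) = T * poly_at p T"
    by (simp add: poly_at_def sum_distrib_left mult_scaleC_right)
  finally show ?thesis .
qed

lemma poly_at_1 [simp]: "poly_at 1 (T :: 'a::cstar_algebra) = 1"
  by (simp add: one_pCons poly_at_pCons scaleC_one)

lemma poly_at_add: "poly_at (p + q) (T :: 'a::cstar_algebra) = poly_at p T + poly_at q T"
proof -
  let ?n = "max (degree p) (degree q)"
  have "poly_at (p + q) T = (\<Sum>i\<le>?n. coeff (p + q) i *\<^sub>C T ^ i)"
    by (intro poly_at_eq_sum degree_add_le_max)
  also have "\<dots> = poly_at p T + poly_at q T"
    by (simp add: poly_at_eq_sum[of p ?n] poly_at_eq_sum[of q ?n] scaleC_add_left sum.distrib)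
  finally show ?thesis .
qed

lemma poly_at_smult: "poly_at (smult a p) (T :: 'a::cstar_algebra) = a *\<^sub>C poly_at p T"
proof -
  have "poly_at (smult a p) T = (\<Sum>i\<le>degree p. coeff (smult a p) i *\<^sub>C T ^ i)"
    by (intro poly_at_eq_sum degree_smult_le)
  also have "\<dots> = a *\<^sub>C poly_at p T"
    by (simp add: poly_at_def scaleC_sum_right scaleC_scaleC)
  finally show ?thesis .
qed

lemma poly_at_diff: "poly_at (p - q) (T :: 'a::cstar_algebra) = poly_at p T - poly_at q T"
  using poly_at_add[of "p - q" q T] by (simp add: eq_diff_eq)

lemma poly_at_mult: "poly_at (p * q) (T :: 'a::cstar_algebra) = poly_at p T * poly_at q T"
  by (induction p)
    (simp_all add: poly_at_pCons poly_at_add poly_at_smult distrib_right mult_scaleC_left mult.assoc)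

lemma poly_at_commute: "poly_at p (T :: 'a::cstar_algebra) * poly_at q T = poly_at q T * poly_at p T"
  by (metis mult.commute poly_at_mult)


section \<open>The von Neumann inequality for isometries\<close>

lemma Cauchy_estimate_coeff:
  assumes "\<And>z. cmod z \<le> 1 \<Longrightarrow> cmod (poly f z) \<le> S"
  shows "cmod (coeff f i) \<le> S"
proof -
  have deriv: "(deriv ^^ n) (poly g) = poly ((pderiv ^^ n) g)" for n and g :: "complex poly"
  proof (induction n)
    case (Suc n)
    have "deriv (poly ((pderiv ^^ n) g)) = poly (pderiv ((pderiv ^^ n) g))"
      by (rule ext) (rule DERIV_imp_deriv, rule poly_DERIV)
    with Suc show ?case by simp
  qed simp
  have "cmod ((deriv ^^ i) (poly f) 0) \<le> fact i * S / 1 ^ i"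
    by (rule Cauchy_inequality) (auto intro!: holomorphic_intros continuous_intros assms)
  moreover have "(deriv ^^ i) (poly f) 0 = fact i * coeff f i"
    by (simp add: deriv poly_0_coeff_0 coeff_higher_pderiv pochhammer_fact)
  ultimately show ?thesis by (simp add: norm_mult)
qed

lemma norm_poly_at_le_degree:
  fixes T :: "'a::cstar_algebra" and S :: real
  assumes "norm T \<le> 1" and S: "\<And>z. cmod z \<le> 1 \<Longrightarrow> cmod (poly f z) \<le> S"
  shows "norm (poly_at f T) \<le> (degree f + 1) * S"
proof -
  have "norm (coeff f i *\<^sub>C T ^ i) \<le> S" for i
  proof -
    have "norm (T ^ i) \<le> 1"
      using norm_power_ineq[of T i] power_le_one[OF norm_ge_zero assms(1), of i] by linarith
    then have "cmod (coeff f i) * norm (T ^ i) \<le> cmod (coeff f i) * 1"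
      by (intro mult_left_mono) auto
    with Cauchy_estimate_coeff[OF S, of i] show ?thesis by (simp add: norm_scaleC)
  qed
  then have "norm (poly_at f T) \<le> (\<Sum>i\<le>degree f. S)"
    unfolding poly_at_def by (intro sum_norm_le) auto
  then show ?thesis by (simp add: algebra_simps)
qed

text \<open>Polynomials in an isometry \<open>V\<close> are hyponormal.  Let \<open>y = \<Sum> cnj c\<^sub>i V\<^bsup>n-i\<^esup>\<close> be the
  reversed polynomial of \<open>x = \<Sum> c\<^sub>i V\<^bsup>i\<^esup>\<close>.  On the unit circle both symbols have the same modulus,
  and this makes \<open>x\<^sup>* x = y\<^sup>* y\<close>, because \<open>V\<^bsup>*i\<^esup> V\<^bsup>j\<^esup>\<close> depends on \<open>j - i\<close> only.  As \<open>x\<^sup>* = V\<^bsup>*n\<^esup> y\<close>, the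
  adjoint \<open>x\<^sup>*\<close> shrinks every element at least as much as \<open>x\<close> does.\<close>

lemma poly_at_isometry_hyponormal:
  fixes V z :: "'a::cstar_algebra"
  assumes V: "adj V * V = 1"
  shows "norm (adj (poly_at f V) * z) \<le> norm (poly_at f V * z)"
proof -
  define n where "n = degree f"
  define x where "x = poly_at f V"
  define y where "y = (\<Sum>i\<le>n. cnj (coeff f i) *\<^sub>C V ^ (n - i))"
  have shift: "adj V ^ (k + i) * V ^ (k + j) = adj V ^ i * V ^ j" for k i j
  proof -
    have "adj V ^ (k + i) * V ^ (k + j) = adj V ^ i * (adj V ^ k * V ^ k) * V ^ j"
      by (simp only: power_add mult.assoc add.commute[of k i])
    then show ?thesis by (simp add: isometry_power[OF V])
  qed
  have toeplitz: "adj V ^ (n - j) * V ^ (n - i) = adj V ^ i * V ^ j" if "i \<le> n" "j \<le> n" for i j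
  proof (cases "i \<le> j")
    case True
    then have "adj V ^ (n - j) * V ^ (n - i) = adj V ^ ((n - j) + 0) * V ^ ((n - j) + (j - i))"
      using that by simp
    also have "\<dots> = adj V ^ (i + 0) * V ^ (i + (j - i))" unfolding shift ..
    finally show ?thesis using True by simp
  next
    case False
    then have "adj V ^ (n - j) * V ^ (n - i) = adj V ^ ((n - i) + (i - j)) * V ^ ((n - i) + 0)"
      using that by simp
    also have "\<dots> = adj V ^ (j + (i - j)) * V ^ (j + 0)" unfolding shift ..
    finally show ?thesis using False by simp
  qed
  have "adj x * x = (\<Sum>i\<le>n. \<Sum>j\<le>n. (cnj (coeff f i) * coeff f j) *\<^sub>C (adj V ^ i * V ^ j))"
    by (simp add: x_def poly_at_def n_def adj_sum adj_scaleC adj_power sum_product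
        mult_scaleC_left mult_scaleC_right scaleC_scaleC mult.commute)
  also have "\<dots> = (\<Sum>i\<le>n. \<Sum>j\<le>n. (cnj (coeff f i) * coeff f j) *\<^sub>C (adj V ^ (n - j) * V ^ (n - i)))"
    by (intro sum.cong refl) (simp add: toeplitz)
  also have "\<dots> = (\<Sum>j\<le>n. \<Sum>i\<le>n. (cnj (coeff f i) * coeff f j) *\<^sub>C (adj V ^ (n - j) * V ^ (n - i)))"
    by (rule sum.swap)
  also have "\<dots> = adj y * y"
    by (simp add: y_def adj_sum adj_scaleC adj_power sum_product
        mult_scaleC_left mult_scaleC_right scaleC_scaleC mult.commute)
  finally have xx: "adj x * x = adj y * y" .
  have xy: "norm (x * z) = norm (y * z)"
  proof (rule norm_eq_of_square_eq)
    have "adj (x * z) * (x * z) = adj z * (adj x * x) * z" by (simp add: adj_mult mult.assoc)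
    also have "\<dots> = adj (y * z) * (y * z)" unfolding xx by (simp add: adj_mult mult.assoc)
    finally show "adj (x * z) * (x * z) = adj (y * z) * (y * z)" .
  qed
  have "adj V ^ n * y = (\<Sum>i\<le>n. cnj (coeff f i) *\<^sub>C (adj V ^ n * V ^ (n - i)))"
    by (simp add: y_def sum_distrib_left mult_scaleC_right)
  also have "\<dots> = (\<Sum>i\<le>n. cnj (coeff f i) *\<^sub>C adj V ^ i)"
  proof (intro sum.cong refl arg_cong[where f = "scaleC _"])
    fix i assume "i \<in> {..n}"
    then show "adj V ^ n * V ^ (n - i) = adj V ^ i"
      using toeplitz[of i 0] toeplitz[of n i] shift[of "n - i" i 0] by simp
  qed
  also have "\<dots> = adj x"
    by (simp add: x_def poly_at_def n_def adj_sum adj_scaleC adj_power)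
  finally have "adj x * z = adj V ^ n * (y * z)" by (metis mult.assoc)
  also have "norm \<dots> \<le> norm (adj V ^ n) * norm (y * z)" by (rule norm_mult_ineq)
  also have "norm (adj V ^ n) = 1"
    by (metis adj_power norm_adj norm_isometry isometry_power[OF V])
  finally show ?thesis using xy by (simp add: x_def)
qed

text \<open>Hyponormality gives \<open>\<parallel>x\<parallel>\<^bsup>m\<^esup> \<le> \<parallel>x\<^bsup>m\<^esup>\<parallel>\<close> for \<open>m = 2\<^bsup>k\<^esup>\<close>, and \<open>x\<^bsup>m\<^esup>\<close> is \<open>f\<^bsup>m\<^esup>\<close> evaluated at \<open>V\<close>,
  whose norm the crude coefficient bound controls up to a factor linear in \<open>m\<close>.  This factor is
  lost when taking \<open>m\<close>-th roots.\<close>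

lemma von_neumann_isometry:
  fixes V :: "'a::cstar_algebra" and S :: real
  assumes V: "adj V * V = 1" and S: "\<And>z. cmod z \<le> 1 \<Longrightarrow> cmod (poly f z) \<le> S"
  shows "norm (poly_at f V) \<le> S"
proof (rule ccontr)
  assume neg: "\<not> norm (poly_at f V) \<le> S"
  have pow: "norm (poly_at f V) ^ (2 ^ k) \<le> norm (poly_at (f ^ (2 ^ k)) V)" for k
  proof (induction k)
    case (Suc k)
    define g where "g = f ^ (2 ^ k)"
    have "norm (poly_at f V) ^ (2 ^ Suc k) = (norm (poly_at f V) ^ (2 ^ k))\<^sup>2"
      by (simp add: power_even_eq)
    also have "\<dots> \<le> (norm (poly_at g V))\<^sup>2"
      using Suc by (intro power_mono) (auto simp: g_def)
    also have "\<dots> = norm (adj (poly_at g V) * poly_at g V)" by (simp add: cstar_identity)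
    also have "\<dots> \<le> norm (poly_at g V * poly_at g V)"
      by (rule poly_at_isometry_hyponormal[OF V])
    also have "poly_at g V * poly_at g V = poly_at (f ^ (2 ^ Suc k)) V"
      by (simp add: g_def power_mult power_mult_distrib power2_eq_square flip: poly_at_mult)
    finally show ?case .
  qed simp
  have S0: "0 \<le> S" using order_trans[OF norm_ge_zero S[of 0]] by simp
  have bound: "norm (poly_at f V) ^ m \<le> (m * degree f + 1) * S ^ m" if m: "m = 2 ^ k" for m k
  proof -
    have "norm (poly_at f V) ^ m \<le> norm (poly_at (f ^ m) V)" using pow m by simp
    also have "\<dots> \<le> (degree (f ^ m) + 1) * S ^ m"
      using norm_isometry[OF V] S
      by (intro norm_poly_at_le_degree) (auto simp: norm_power intro!: power_mono)
    also have "\<dots> \<le> (m * degree f + 1) * S ^ m"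
      using degree_power_le[of f m] S0
      by (intro mult_right_mono) (auto simp: mult.commute simp flip: of_nat_mult of_nat_Suc)
    finally show ?thesis by simp
  qed
  have "S \<noteq> 0" using bound[of 1 0] neg by auto
  with S0 have "0 < S" by simp
  define t where "t = norm (poly_at f V) / S"
  have "1 < t" using neg \<open>0 < S\<close> by (simp add: t_def field_simps)
  have "t ^ (2 ^ k) \<le> 2 ^ k * real (degree f) + 1" for k
    using bound[OF refl, of k] \<open>0 < S\<close> by (simp add: t_def power_divide field_simps)
  moreover have "\<exists>k. 2 ^ k * real (degree f) + 1 < t ^ (2 ^ k)"
  proof -
    have "eventually (\<lambda>m::nat. real m * real (degree f) + 1 < t ^ m) sequentially"
      using \<open>1 < t\<close> by real_asymp
    then obtain M where "\<forall>m\<ge>M. real m * real (degree f) + 1 < t ^ m"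
      by (auto simp: eventually_sequentially)
    moreover have "M \<le> 2 ^ M" by (simp add: less_imp_le)
    ultimately have "real (2 ^ M) * real (degree f) + 1 < t ^ (2 ^ M)" by blast
    then show ?thesis by auto
  qed
  ultimately show False by (meson not_le)
qed


section \<open>Contractions with a defect operator\<close>

lemma orthogonal_isometries_square:
  fixes u w X Y :: "'a::cstar_algebra"
  assumes u: "adj u * u = 1" and w: "adj w * w = 1" and uw: "adj u * w = 0"
  shows "adj (u * X + w * Y) * (u * X + w * Y) = adj X * X + adj Y * Y"
proof -
  have wu: "adj w * u = 0" using arg_cong[OF uw, of adj] by (simp add: adj_mult adj_adj)
  have r: "adj u * (u * z) = z" "adj w * (w * z) = z" "adj u * (w * z) = 0" "adj w * (u * z) = 0" for z
    using u w uw wu by (simp_all flip: mult.assoc)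
  show ?thesis by (simp add: adj_add adj_mult distrib_left distrib_right mult.assoc r)
qed

text \<open>If \<open>1 - T\<^sup>* T = D\<^sup>* D\<close>, then \<open>T\<close> has an isometric dilation.  Two isometries \<open>u\<close>, \<open>w\<close> with
  orthogonal ranges provide the room for it inside the algebra: on the range of \<open>u\<close>, seen as a
  copy of the space that \<open>T\<close> acts on, the dilation \<open>V\<close> is the column of \<open>T\<close> and \<open>D\<close>, and it
  shifts the complement by \<open>w\<^sup>2\<close>.  Since \<open>u\<^sup>* V = T u\<^sup>*\<close>, the inequality passes from \<open>V\<close> to \<open>T\<close>.\<close>

lemma von_neumann_defect:
  fixes T D u w :: "'a::cstar_algebra" and S :: real
  assumes u: "adj u * u = 1" and w: "adj w * w = 1" and uw: "adj u * w = 0"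
    and TD: "adj T * T + adj D * D = 1"
    and S: "\<And>z. cmod z \<le> 1 \<Longrightarrow> cmod (poly f z) \<le> S"
  shows "norm (poly_at f T) \<le> S"
proof -
  define Y where "Y = u * (D * adj u) + w * (1 - u * adj u)"
  define V where "V = u * (T * adj u) + w * Y"
  have proj: "adj (1 - u * adj u) * (1 - u * adj u) = 1 - u * adj u"
  proof -
    have "u * adj u * (u * adj u) = u * (adj u * u) * adj u" by (simp only: mult.assoc)
    then show ?thesis by (simp add: u adj_diff adj_mult adj_adj algebra_simps)
  qed
  have "adj V * V = adj (T * adj u) * (T * adj u) + adj Y * Y"
    unfolding V_def by (rule orthogonal_isometries_square[OF u w uw])
  also have "adj Y * Y = adj (D * adj u) * (D * adj u) + (1 - u * adj u)"
    unfolding Y_def orthogonal_isometries_square[OF u w uw] proj ..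
  also have "adj (T * adj u) * (T * adj u) + \<dots>
      = u * (adj T * T + adj D * D) * adj u + (1 - u * adj u)"
    by (simp add: adj_mult adj_adj algebra_simps)
  finally have V: "adj V * V = 1" by (simp add: TD)
  have inter: "adj u * (V * z) = T * (adj u * z)" for z
  proof -
    have "adj u * V = (adj u * u) * T * adj u + (adj u * w) * Y"
      by (simp only: V_def distrib_left mult.assoc)
    then have "adj u * V = T * adj u" by (simp add: u uw)
    then show ?thesis by (simp flip: mult.assoc)
  qed
  have "adj u * poly_at f V = poly_at f T * adj u"
    by (induction f)
      (simp_all add: poly_at_pCons distrib_left distrib_right inter mult.assoc
        mult_scaleC_left mult_scaleC_right)
  then have "poly_at f T * adj u * u = adj u * poly_at f V * u" by simp
  then have "poly_at f T = adj u * (poly_at f V * u)" by (simp add: mult.assoc u)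
  also have "norm \<dots> \<le> norm (adj u) * norm (poly_at f V * u)" by (rule norm_mult_ineq)
  also have "\<dots> \<le> norm (poly_at f V)"
    using norm_mult_ineq[of "poly_at f V" u] by (simp add: norm_isometry[OF u])
  also have "\<dots> \<le> S" by (rule von_neumann_isometry[OF V S])
  finally show ?thesis .
qed


section \<open>From polynomials to rational functions\<close>

lemma poly_inverse_approximation:
  fixes q :: "complex poly"
  assumes "\<And>z. cmod z \<le> 1 \<Longrightarrow> poly q z \<noteq> 0" and "0 < e"
  shows "\<exists>f. \<forall>z. cmod z \<le> 1 \<longrightarrow> cmod (poly (f * q) z - 1) < e"
  using assms
proof (induction "degree q" arbitrary: q e)
  case 0
  then obtain c where "q = [:c:]" using degree_eq_zeroE by metis
  moreover have "c \<noteq> 0" using 0(2)[of 0] calculation by simp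
  ultimately show ?case using 0 by (intro exI[of _ "[:1 / c:]"]) simp
next
  case (Suc n)
  have "\<not> constant (poly q)" using Suc(2) by (simp add: constant_degree)
  then obtain \<alpha> where \<alpha>: "poly q \<alpha> = 0" using fundamental_theorem_of_algebra by blast
  then have "1 < cmod \<alpha>" using Suc(3) by (meson not_le)
  from \<alpha> obtain q' where q: "q = [:- \<alpha>, 1:] * q'" by (auto simp: poly_eq_0_iff_dvd elim: dvdE)
  have "q' \<noteq> 0" using Suc(2) q by auto
  then have "n = degree q'" using Suc(2) by (simp add: q degree_mult_eq del: mult_pCons_left)
  moreover have "poly q' z \<noteq> 0" if "cmod z \<le> 1" for z using Suc(3)[OF that] by (simp add: q)
  moreover define \<delta> where "\<delta> = min 1 (e / 3)"
  have "0 < \<delta>" "\<delta> \<le> 1" "3 * \<delta> \<le> e" using Suc(4) by (auto simp: \<delta>_def)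
  ultimately obtain f' where f': "\<And>z. cmod z \<le> 1 \<Longrightarrow> cmod (poly (f' * q') z - 1) < \<delta>"
    using Suc(1)[of q' \<delta>] by auto
  \<comment> \<open>A truncated geometric series inverts the linear factor up to \<open>(z / \<alpha>)\<^bsup>m\<^esup>\<close>.\<close>
  obtain m where m: "(1 / cmod \<alpha>) ^ m < \<delta>"
    using real_arch_pow_inv[OF \<open>0 < \<delta>\<close>, of "1 / cmod \<alpha>"] \<open>1 < cmod \<alpha>\<close>
    by (auto simp: divide_less_eq_1)
  define g where "g = smult (- 1 / \<alpha>) (\<Sum>k<m. [:0, 1 / \<alpha>:] ^ k)"
  have g: "cmod (poly (g * [:- \<alpha>, 1:]) z - 1) < \<delta>" if z: "cmod z \<le> 1" for z
  proof -
    have "\<alpha> \<noteq> 0" using \<open>1 < cmod \<alpha>\<close> by auto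
    have "poly (g * [:- \<alpha>, 1:]) z = (1 - z / \<alpha>) * (\<Sum>k<m. (z / \<alpha>) ^ k)"
      using \<open>\<alpha> \<noteq> 0\<close> by (simp add: g_def poly_sum field_simps)
    also have "\<dots> = 1 - (z / \<alpha>) ^ m" by (rule one_diff_power_eq[symmetric])
    finally have "cmod (poly (g * [:- \<alpha>, 1:]) z - 1) = (cmod z * (1 / cmod \<alpha>)) ^ m"
      by (simp add: norm_power norm_divide)
    also have "\<dots> \<le> (1 / cmod \<alpha>) ^ m"
      using z \<open>1 < cmod \<alpha>\<close> by (intro power_mono) (auto simp: divide_right_mono)
    finally show ?thesis using m by simp
  qed
  have "cmod (poly (g * f' * q) z - 1) < e" if z: "cmod z \<le> 1" for z
  proof -
    define a where "a = poly (g * [:- \<alpha>, 1:]) z - 1"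
    define b where "b = poly (f' * q') z - 1"
    have ab: "cmod a < \<delta>" "cmod b < \<delta>" using g[OF z] f'[OF z] by (simp_all only: a_def b_def)
    have "poly (g * f' * q) z = (a + 1) * (b + 1)"
      by (simp add: q a_def b_def del: mult_pCons_left mult_pCons_right)
    then have "poly (g * f' * q) z - 1 = a * b + a + b" by (simp add: algebra_simps)
    also have "cmod \<dots> \<le> cmod a * cmod b + cmod a + cmod b"
      by (metis add_mono norm_mult norm_triangle_le order_refl)
    also have "\<dots> < \<delta> + \<delta> + \<delta>"
      using mult_mono[of "cmod a" \<delta> "cmod b" 1] ab \<open>\<delta> \<le> 1\<close> by auto
    also have "\<dots> \<le> e" using \<open>3 * \<delta> \<le> e\<close> by simp
    finally show ?thesis .
  qed
  then show ?case by blast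
qed

lemma alg_inverse_unique:
  fixes x :: "'a::cstar_algebra"
  assumes "x * y = 1" and "y * x = 1"
  shows "alg_inverse x = y"
  unfolding alg_inverse_def using assms
  by (intro the_equality) (auto, metis mult.assoc mult.left_neutral mult.right_neutral)

lemma alg_invertible_near_1:
  fixes x :: "'a::cstar_algebra"
  assumes "norm (x - 1) < 1"
  shows "alg_invertible x"
proof -
  define y where "y = 1 - x"
  have "norm y < 1" using assms by (simp add: y_def norm_minus_commute)
  then have sum: "summable (\<lambda>n. y ^ n)" by (rule complete_algebra_summable_geometric)
  define R where "R = (\<Sum>n. y ^ n)"
  have "R = 1 + (\<Sum>n. y ^ Suc n)" using suminf_split_head[OF sum] by (simp add: R_def)
  moreover have "(\<Sum>n. y ^ Suc n) = y * R" using suminf_mult[OF sum, of y] by (simp add: R_def)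
  moreover have "(\<Sum>n. y ^ Suc n) = R * y"
    using suminf_mult2[OF sum, of y] by (simp add: R_def power_commutes)
  ultimately have "x * R = 1" "R * x = 1" by (simp_all add: y_def algebra_simps)
  then show ?thesis unfolding alg_invertible_def by blast
qed

lemma spectral_set_disc:
  fixes T :: "'a::cstar_algebra"
  assumes vN: "\<And>f S. (\<And>z. cmod z \<le> 1 \<Longrightarrow> cmod (poly f z) \<le> S) \<Longrightarrow> norm (poly_at f T) \<le> S"
  shows "spectral_set (cball 0 1) T"
proof -
  have inv: "alg_invertible (poly_at q T)" if q: "\<And>z. cmod z \<le> 1 \<Longrightarrow> poly q z \<noteq> 0" for q
  proof -
    obtain f where f: "\<And>z. cmod z \<le> 1 \<Longrightarrow> cmod (poly (f * q) z - 1) < 1 / 2"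
      using poly_inverse_approximation[of q "1 / 2"] q by auto
    have "norm (poly_at (f * q - 1) T) \<le> 1 / 2"
      using f by (intro vN) (auto intro: less_imp_le)
    then have "alg_invertible (poly_at (f * q) T)"
      by (intro alg_invertible_near_1) (simp add: poly_at_diff)
    then obtain R where R: "poly_at f T * poly_at q T * R = 1" "R * (poly_at f T * poly_at q T) = 1"
      unfolding alg_invertible_def poly_at_mult by blast
    have "poly_at q T * (poly_at f T * R) = 1"
      using R(1) by (metis mult.assoc poly_at_commute)
    moreover have "(R * poly_at f T) * poly_at q T = 1"
      using R(2) by (simp add: mult.assoc)
    ultimately show ?thesis
      unfolding alg_invertible_def by (metis mult.assoc mult.left_neutral mult.right_neutral)
  qed
  have spec: "spectrum T \<subseteq> cball 0 1"
  proof
    fix l assume l: "l \<in> spectrum T"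
    have "\<not> alg_invertible (poly_at [:l, - 1:] T)"
      using l by (simp add: spectrum_def poly_at_pCons scaleC_minus_left scaleC_one)
    then obtain z where "cmod z \<le> 1" "l = z" using inv[of "[:l, - 1:]"] by auto
    then show "l \<in> cball 0 1" by simp
  qed
  have main: "norm (poly_at p T * alg_inverse (poly_at q T))
      \<le> (SUP z\<in>cball 0 1. cmod (poly p z / poly q z))" (is "?lhs \<le> ?S")
    if q0: "\<forall>z\<in>cball 0 1. poly q z \<noteq> 0" for p q
  proof -
    have q: "poly q z \<noteq> 0" if "cmod z \<le> 1" for z using q0 that by simp
    obtain R where R: "poly_at q T * R = 1" "R * poly_at q T = 1"
      using inv[OF q] unfolding alg_invertible_def by blast
    have "compact ((\<lambda>z. cmod (poly p z / poly q z)) ` cball 0 1)"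
      using q0 by (intro compact_continuous_image continuous_intros) auto
    then have "bdd_above ((\<lambda>z. cmod (poly p z / poly q z)) ` cball 0 1)"
      by (intro bounded_imp_bdd_above compact_imp_bounded)
    then have sup: "cmod (poly p z / poly q z) \<le> ?S" if "cmod z \<le> 1" for z
      using that by (intro cSUP_upper) auto
    have "compact ((\<lambda>z. cmod (poly p z)) ` cball 0 1)"
      by (intro compact_continuous_image continuous_intros) auto
    then obtain M where "\<forall>z\<in>cball 0 1. cmod (poly p z) \<le> M"
      by (auto dest!: compact_imp_bounded simp: bounded_iff)
    then have M: "cmod (poly p z) \<le> M" if "cmod z \<le> 1" for z
      using that by simp
    define C where "C = ?S + M * norm R"
    have approx: "norm (poly_at p T * R) \<le> ?S + e * C" if "0 < e" for e
    proof -
      obtain f where f: "\<And>z. cmod z \<le> 1 \<Longrightarrow> cmod (poly (f * q) z - 1) < e"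
        using poly_inverse_approximation[of q e] q \<open>0 < e\<close> by auto
      have "norm (poly_at (p * (1 - f * q)) T) \<le> M * e"
      proof (rule vN)
        fix z assume z: "cmod z \<le> 1"
        have "cmod (poly p z) * cmod (1 - poly (f * q) z) \<le> M * e"
          using M[OF z] f[OF z] order_trans[OF norm_ge_zero M[OF z]]
          by (intro mult_mono) (auto simp: norm_minus_commute)
        then show "cmod (poly (p * (1 - f * q)) z) \<le> M * e" by (simp add: norm_mult)
      qed
      then have 1: "norm (poly_at (p * (1 - f * q)) T * R) \<le> M * e * norm R"
        by (meson mult_right_mono norm_ge_zero norm_mult_ineq order_trans)
      have 2: "norm (poly_at (p * f) T) \<le> ?S * (1 + e)"
      proof (rule vN)
        fix z assume z: "cmod z \<le> 1"
        have "poly (p * f) z = (poly p z / poly q z) * poly (f * q) z"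
          using q[OF z] by simp
        moreover have "cmod (poly (f * q) z) \<le> 1 + e"
          using norm_triangle_sub[of "poly (f * q) z" 1] f[OF z] by simp
        ultimately show "cmod (poly (p * f) z) \<le> ?S * (1 + e)"
          using sup[OF z] order_trans[OF norm_ge_zero sup[OF z]]
          by (simp only: norm_mult) (intro mult_mono; simp)
      qed
      have "poly_at p T * R = poly_at (p * (1 - f * q)) T * R + poly_at (p * f) T * (poly_at q T * R)"
        by (simp add: poly_at_mult poly_at_diff algebra_simps)
      then have "norm (poly_at p T * R) \<le> M * e * norm R + ?S * (1 + e)"
        using 1 2 by (simp add: R norm_triangle_le)
      then show ?thesis by (simp add: C_def algebra_simps)
    qed
    have "((\<lambda>e. ?S + e * C) \<longlongrightarrow> ?S + 0 * C) (at_right 0)"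
      by (intro tendsto_intros)
    moreover have "\<forall>\<^sub>F e in at_right 0. norm (poly_at p T * R) \<le> ?S + e * C"
      using approx by (intro eventually_at_rightI[of 0 1]) auto
    ultimately have "norm (poly_at p T * R) \<le> ?S + 0 * C"
      by (rule tendsto_lowerbound) simp
    then show ?thesis unfolding alg_inverse_unique[OF R] by simp
  qed
  show ?thesis
    unfolding spectral_set_def by (intro conjI allI impI compact_cball spec main)
qed


section \<open>Minimality of the disc\<close>

text \<open>A proper closed subset \<open>Y\<close> of the disc misses a neighbourhood of some point \<open>a\<close> with
  \<open>0 < \<bar>a\<bar> < 1\<close>.  For small \<open>c > 0\<close> the function \<open>r(z) = z (1 - c z / (z - a))\<close> satisfies \<open>r(0) = 0\<close>,
  \<open>r'(0) = 1\<close>, and yet \<open>\<bar>r\<bar> < 1\<close> on \<open>Y\<close>, so the Schwarz lemma fails on \<open>Y\<close>: for \<open>\<bar>z\<bar> \<ge> \<bar>a\<bar>\<close> the real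
  part of \<open>z / (z - a)\<close> is at least \<open>1/2\<close>, and for \<open>\<bar>z\<bar> \<le> \<bar>a\<bar>\<close> the factor \<open>z\<close> leaves enough room.
  Here \<open>r = p / q\<close> with \<open>q = z - a\<close>.\<close>

lemma Schwarz_lemma_fails:
  fixes Y :: "complex set"
  assumes "closed Y" and "Y \<subset> cball 0 1"
  shows "\<exists>a c \<rho>. a \<noteq> 0 \<and> a \<notin> Y \<and> \<rho> < 1 \<and> 0 \<le> \<rho> \<and>
    (\<forall>z\<in>Y. cmod (z * (1 - of_real c * z / (z - a))) \<le> \<rho>)"
proof -
  obtain b where b: "cmod b \<le> 1" "b \<notin> Y" using psubset_imp_ex_mem[OF assms(2)] by auto
  obtain r where r: "0 < r" "ball b r \<subseteq> - Y"
    using assms(1) b(2) by (metis Compl_iff open_Compl openE)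
  have "b \<in> closure (ball 0 1)" using b(1) by simp
  then obtain a0 where a0: "cmod a0 < 1" "dist a0 b < r / 2"
    using closure_approachable[of b "ball 0 1"] r(1) by (metis dist_0_norm half_gt_zero mem_ball)
  obtain a where a: "cmod a < 1" "a \<noteq> 0" "dist a b < r"
  proof (cases "a0 = 0")
    case True
    define t where "t = min (1 / 2) (r / 4)"
    have "0 < t" "t < 1" "t < r / 2" using r(1) by (auto simp: t_def)
    moreover have "dist (complex_of_real t) b \<le> dist (complex_of_real t) 0 + dist 0 b"
      by (rule dist_triangle)
    ultimately show ?thesis using a0 True by (intro that[of "of_real t"]) auto
  next
    case False
    then show ?thesis using a0 r(1) by (intro that[of a0]) auto
  qed
  define \<delta> where "\<delta> = r - dist a b"
  have "0 < \<delta>" using a by (simp add: \<delta>_def)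
  have far: "\<delta> \<le> cmod (z - a)" if "z \<in> Y" for z
  proof (rule ccontr)
    assume "\<not> \<delta> \<le> cmod (z - a)"
    then have "dist z a < \<delta>" by (simp add: dist_norm)
    then have "z \<in> ball b r" using dist_triangle[of z b a] by (simp add: \<delta>_def dist_commute)
    with r(2) that show False by auto
  qed
  then have "a \<notin> Y" using \<open>0 < \<delta>\<close> by fastforce
  define c where "c = min (\<delta>\<^sup>2 / 2) (\<delta> * (1 - cmod a) / 2)"
  have c: "0 < c" "c \<le> \<delta>\<^sup>2 / 2" "c \<le> \<delta> * (1 - cmod a) / 2"
    using \<open>0 < \<delta>\<close> a(1) by (auto simp: c_def)
  define \<rho> where "\<rho> = max (sqrt (1 - c / 2)) ((1 + cmod a) / 2)"
  have "\<rho> < 1" "0 \<le> \<rho>" using c(1) a(1) by (auto simp: \<rho>_def le_max_iff_disj add_nonneg_nonneg)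
  moreover have "cmod (z * (1 - of_real c * z / (z - a))) \<le> \<rho>" if z: "z \<in> Y" for z
  proof -
    define m where "m = z / (z - a)"
    have z1: "cmod z \<le> 1" using z assms(2) by auto
    have "z \<noteq> a" using z \<open>a \<notin> Y\<close> by auto
    have m: "cmod m \<le> 1 / \<delta>"
      unfolding m_def norm_divide using z1 far[OF z] \<open>0 < \<delta>\<close> by (intro frac_le) auto
    show ?thesis
    proof (cases "cmod a \<le> cmod z")
      case True
      \<comment> \<open>\<open>Re (1 / w) \<ge> 1/2\<close> holds exactly when \<open>w\<close> is in the disc of radius 1 about 1; here
        \<open>w = 1 - a / z\<close>.\<close>
      have "1 / 2 \<le> Re m"
      proof -
        have Re_m: "Re m = Re (z * cnj (z - a)) / (cmod (z - a))\<^sup>2"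
          unfolding m_def by (subst complex_div_cnj) (simp add: Re_divide_of_real flip: of_real_power)
        have "2 * Re (z * cnj (z - a)) - (cmod (z - a))\<^sup>2 = (cmod z)\<^sup>2 - (cmod a)\<^sup>2"
          unfolding cmod_power2 by (simp add: power2_eq_square algebra_simps)
        moreover have "(cmod a)\<^sup>2 \<le> (cmod z)\<^sup>2" using True by (intro power_mono) auto
        moreover have "0 < (cmod (z - a))\<^sup>2" using \<open>z \<noteq> a\<close> by simp
        ultimately show ?thesis unfolding Re_m by (subst pos_le_divide_eq) linarith+
      qed
      have "(cmod (1 - of_real c * m))\<^sup>2 = 1 - 2 * c * Re m + c\<^sup>2 * (cmod m)\<^sup>2"
        unfolding cmod_power2 by (simp add: power2_eq_square algebra_simps)
      also have "\<dots> \<le> 1 - c + c * (\<delta>\<^sup>2 / 2) * (1 / \<delta>)\<^sup>2"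
      proof -
        have "c * 1 \<le> c * (2 * Re m)" using c(1) \<open>1 / 2 \<le> Re m\<close> by (intro mult_left_mono) auto
        moreover have "c * c * (cmod m)\<^sup>2 \<le> c * (\<delta>\<^sup>2 / 2) * (1 / \<delta>)\<^sup>2"
          using c m by (intro mult_mono power_mono) auto
        ultimately show ?thesis by (simp add: power2_eq_square)
      qed
      also have "\<dots> = 1 - c / 2" using \<open>0 < \<delta>\<close> by (simp add: field_simps power2_eq_square)
      finally have "cmod (1 - of_real c * m) \<le> sqrt (1 - c / 2)" by (rule real_le_rsqrt)
      moreover have "cmod z * cmod (1 - of_real c * m) \<le> 1 * cmod (1 - of_real c * m)"
        using z1 by (intro mult_right_mono) auto
      ultimately show ?thesis by (simp add: \<rho>_def m_def norm_mult flip: norm_mult)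
    next
      case False
      have "cmod (1 - of_real c * m) \<le> 1 + c * (1 / \<delta>)"
      proof -
        have "cmod (1 - of_real c * m) \<le> 1 + c * cmod m"
          using norm_triangle_ineq4[of 1 "of_real c * m"] c(1) by (simp add: norm_mult)
        moreover have "c * cmod m \<le> c * (1 / \<delta>)" using m c(1) by (intro mult_left_mono) auto
        ultimately show ?thesis by linarith
      qed
      also have "c * (1 / \<delta>) \<le> (1 - cmod a) / 2"
        using c(3) \<open>0 < \<delta>\<close> by (simp add: field_simps)
      finally have 1: "cmod (1 - of_real c * m) \<le> 1 + (1 - cmod a) / 2" by simp
      have "cmod z * cmod (1 - of_real c * m) \<le> cmod a * (1 + (1 - cmod a) / 2)"
        using 1 False by (intro mult_mono) auto
      also have "\<dots> \<le> (1 + cmod a) / 2"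
      proof -
        have "0 \<le> (1 - cmod a) * (1 - cmod a)" by simp
        then show ?thesis by (simp add: field_simps)
      qed
      also have "\<dots> \<le> \<rho>" by (simp add: \<rho>_def)
      finally show ?thesis by (simp add: m_def norm_mult)
    qed
  qed
  ultimately show ?thesis using a(2) \<open>a \<notin> Y\<close> by blast
qed

text \<open>On the span of \<open>x\<close> and \<open>y\<close>, the element \<open>T\<close> acts as a nilpotent Jordan block, so that every
  rational \<open>r\<close> with \<open>r(0) = 0\<close> maps \<open>x\<close> to \<open>r'(0) y\<close>.  Hence \<open>\<parallel>r(T)\<parallel> \<ge> \<bar>r'(0)\<bar>\<close>, and a function
  violating the Schwarz lemma on \<open>Y\<close> shows that \<open>Y\<close> is not a spectral set.\<close>

lemma minimal_spectral_set_disc: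
  fixes T x y :: "'a::cstar_algebra"
  assumes disc: "spectral_set (cball 0 1) T"
    and x: "adj x * x = 1" and y: "adj y * y = 1" and Tx: "T * x = y" and Ty: "T * y = 0"
  shows "minimal_spectral_set (cball 0 1) T"
  unfolding minimal_spectral_set_def
proof (intro conjI allI impI notI)
  fix Y assume Y: "closed Y \<and> Y \<subset> cball 0 1" and spec: "spectral_set Y T"
  obtain a c \<rho> where "a \<noteq> 0" "a \<notin> Y" and \<rho>: "\<rho> < 1" "0 \<le> \<rho>"
    and le: "\<And>z. z \<in> Y \<Longrightarrow> cmod (z * (1 - of_real c * z / (z - a))) \<le> \<rho>"
    using Schwarz_lemma_fails[of Y] Y by blast
  have "y \<noteq> 0" using y by auto
  have "0 \<in> spectrum T"
  proof (rule ccontr)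
    assume "0 \<notin> spectrum T"
    then obtain R where "R * (0 *\<^sub>C 1 - T) = 1" by (auto simp: spectrum_def alg_invertible_def)
    then have "y = R * (0 *\<^sub>C 1 - T) * y" by simp
    also have "\<dots> = 0" by (simp add: mult.assoc Ty)
    finally show False using \<open>y \<noteq> 0\<close> by contradiction
  qed
  then have "0 \<in> Y" using spec by (auto simp: spectral_set_def)
  define q where "q = [:- a, 1:]"
  define p where "p = [:0, - a, 1 - of_real c:]"
  have q0: "\<forall>z\<in>Y. poly q z \<noteq> 0" using \<open>a \<notin> Y\<close> by (auto simp: q_def)
  have "(SUP z\<in>Y. cmod (poly p z / poly q z)) \<le> \<rho>"
  proof (rule cSUP_least)
    fix z assume z: "z \<in> Y"
    have "poly p z / poly q z = z * (1 - of_real c * z / (z - a))"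
      using q0 z by (auto simp: p_def q_def field_simps)
    with le[OF z] show "cmod (poly p z / poly q z) \<le> \<rho>" by simp
  qed (use \<open>0 \<in> Y\<close> in auto)
  then have r: "norm (poly_at p T * alg_inverse (poly_at q T)) \<le> \<rho>"
    using spec q0 unfolding spectral_set_def by (meson order_trans)
  have qT: "poly_at q T = T - a *\<^sub>C 1"
    by (simp add: q_def poly_at_pCons scaleC_minus_left scaleC_one)
  obtain R0 where "(a *\<^sub>C 1 - T) * R0 = 1" "R0 * (a *\<^sub>C 1 - T) = 1"
  proof -
    have "a \<notin> spectrum T" using \<open>a \<notin> Y\<close> spec by (auto simp: spectral_set_def)
    then show ?thesis by (auto simp: spectrum_def alg_invertible_def intro: that)
  qed
  then have "poly_at q T * (- R0) = 1" "(- R0) * poly_at q T = 1"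
    by (simp_all add: qT algebra_simps)
  then obtain R where R: "poly_at q T * R = 1" "R * poly_at q T = 1" by blast
  have "poly_at p T * R * x = y"
  proof -
    have px: "poly_at p T * x = poly_at q T * y"
      using Tx Ty by (simp add: p_def qT poly_at_pCons distrib_right left_diff_distrib mult.assoc
          mult_scaleC_left mult_scaleC_right scaleC_minus_left scaleC_minus_right distrib_left
          right_diff_distrib)
    have "poly_at p T * R = (R * poly_at q T) * (poly_at p T * R)" by (simp add: R(2))
    also have "\<dots> = R * (poly_at q T * poly_at p T) * R" by (simp only: mult.assoc)
    also have "\<dots> = R * poly_at p T * (poly_at q T * R)"
      unfolding poly_at_commute[of q T p] by (simp only: mult.assoc)
    also have "\<dots> = R * poly_at p T" by (simp add: R(1))
    finally have "poly_at p T * R * x = R * (poly_at p T * x)" by (simp add: mult.assoc)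
    also have "\<dots> = (R * poly_at q T) * y" unfolding px by (simp only: mult.assoc)
    finally show ?thesis by (simp add: R(2))
  qed
  then have "1 \<le> norm (poly_at p T * R) * 1"
    using norm_mult_ineq[of "poly_at p T * R" x] norm_isometry[OF x] norm_isometry[OF y] by simp
  with r \<rho> show False unfolding alg_inverse_unique[OF R] by simp
qed (rule disc)


section \<open>Orthogonality of the ranges in a Cuntz family\<close>

text \<open>The two bounds say that \<open>-b\<close> and \<open>b\<close> are positive.  A convexity argument replaces the usual one
  with the spectrum: \<open>1 + (4/3) b\<close> is the average of \<open>(1 + b)\<^sup>2 (1 - b\<^sup>2)\<close>, \<open>(1 + b)\<^sup>3\<close>, \<open>1 - 3 b\<^sup>2\<close> and
  \<open>1 + b\<^sup>4\<close> with weights \<open>1/6, 1/3, 1/3, 1/6\<close>.  All of these have norm at most 1.  Indeed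
  \<open>1 - b\<^sup>2 = (1 + b) (1 - b)\<close>, while \<open>1 + b\<^sup>2\<close> is the mean of \<open>(1 + b)\<^sup>2\<close> and \<open>(1 - b)\<^sup>2\<close>, and \<open>1 - 3 b\<^sup>2\<close> is the
  mean of \<open>(1 + \<i>b)\<^sup>3\<close> and \<open>(1 - \<i>b)\<^sup>3\<close>, where \<open>\<parallel>1 \<plusminus> \<i>b\<parallel>\<^sup>2 = \<parallel>1 + b\<^sup>2\<parallel>\<close> by self-adjointness.  So \<open>b\<close> may be
  replaced by \<open>(4/3) b\<close> again and again, whereas \<open>\<parallel>b\<parallel> \<le> 1\<close> under the hypotheses.\<close>

lemma self_adjoint_eq_0I:
  fixes b :: "'a::cstar_algebra"
  assumes "adj b = b" and "norm (1 + b) \<le> 1" and "norm (1 - b) \<le> 1"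
  shows "b = 0"
proof -
  have prod: "norm (x * y) \<le> 1" if "norm x \<le> 1" "norm y \<le> 1" for x y :: 'a
    using norm_mult_ineq[of x y] mult_mono[OF that] by simp
  have square: "norm (1 + c * c) \<le> 1 \<and> norm (1 - c * c) \<le> 1"
    if "norm (1 + c) \<le> 1" "norm (1 - c) \<le> 1" for c :: 'a
  proof
    have "(1 + c * c) = (1 / 2) *\<^sub>R ((1 + c) * (1 + c) + (1 - c) * (1 - c))"
      by (simp add: algebra_simps flip: scaleR_2)
    also have "norm \<dots> \<le> 1"
      using norm_triangle_ineq[of "(1 + c) * (1 + c)" "(1 - c) * (1 - c)"] that
        prod[of "1 + c" "1 + c"] prod[of "1 - c" "1 - c"] by simp
    finally show "norm (1 + c * c) \<le> 1" .
    have "1 - c * c = (1 + c) * (1 - c)" by (simp add: algebra_simps)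
    also have "norm \<dots> \<le> 1" using that by (intro prod)
    finally show "norm (1 - c * c) \<le> 1" .
  qed
  have expand: "norm (1 + (4 / 3) *\<^sub>R c) \<le> 1"
    if c: "adj c = c" "norm (1 + c) \<le> 1" "norm (1 - c) \<le> 1" for c :: 'a
  proof -
    define i where "i = \<i> *\<^sub>C c"
    have ii: "i * i = - (c * c)"
      by (simp add: i_def mult_scaleC_left mult_scaleC_right scaleC_scaleC scaleC_minus_left scaleC_one)
    have "adj i = - i" by (simp add: i_def adj_scaleC c(1) scaleC_minus_left)
    then have "adj (1 + i) * (1 + i) = 1 + c * c" "adj (1 - i) * (1 - i) = 1 + c * c"
      by (simp_all add: adj_add adj_diff ii algebra_simps)
    then have "(norm (1 + i))\<^sup>2 \<le> 1" "(norm (1 - i))\<^sup>2 \<le> 1"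
      using square[OF c(2,3)] by (metis cstar_identity)+
    then have i: "norm (1 + i) \<le> 1" "norm (1 - i) \<le> 1"
      by (simp_all add: power_le_one_iff)
    define A where "A = (1 + c) * ((1 + c) * (1 - c * c))"
    define B where "B = (1 + c) * ((1 + c) * (1 + c))"
    define C1 where "C1 = (1 + i) * ((1 + i) * (1 + i))"
    define C2 where "C2 = (1 - i) * ((1 - i) * (1 - i))"
    define E where "E = 1 + (c * c) * (c * c)"
    have n: "norm A \<le> 1" "norm B \<le> 1" "norm C1 \<le> 1" "norm C2 \<le> 1" "norm E \<le> 1"
      unfolding A_def B_def C1_def C2_def E_def
      using c(2,3) i square[OF c(2,3)] square[of "c * c"] by (auto intro!: prod)
    have multiple: "6 *\<^sub>R x = x + x + x + x + x + x" "8 *\<^sub>R x = x + x + x + x + x + x + x + x"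
      for x :: 'a
    proof -
      have "6 *\<^sub>R x = (1 + 1 + 1 + 1 + 1 + 1 :: real) *\<^sub>R x"
        "8 *\<^sub>R x = (1 + 1 + 1 + 1 + 1 + 1 + 1 + 1 :: real) *\<^sub>R x" by simp_all
      then show "6 *\<^sub>R x = x + x + x + x + x + x" "8 *\<^sub>R x = x + x + x + x + x + x + x + x"
        by (simp_all only: scaleR_left_distrib scaleR_one)
    qed
    have C: "C1 + C2 = 2 *\<^sub>R 1 - 6 *\<^sub>R (c * c)"
    proof -
      have "C1 + C2 = 2 *\<^sub>R 1 + 6 *\<^sub>R (i * i)"
        by (simp add: C1_def C2_def algebra_simps scaleR_2 multiple)
      then show ?thesis by (simp add: ii)
    qed
    have "6 *\<^sub>R (1 + (4 / 3) *\<^sub>R c) = A + 2 *\<^sub>R B + (C1 + C2) + E"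
      unfolding C by (simp add: A_def B_def E_def algebra_simps scaleR_2 multiple)
    moreover have "norm (A + 2 *\<^sub>R B + (C1 + C2) + E) \<le> 1 + 2 * 1 + (1 + 1) + 1"
      using n by (intro norm_triangle_le add_mono) auto
    ultimately have "norm (6 *\<^sub>R (1 + (4 / 3) *\<^sub>R c)) \<le> 6" by simp
    then show ?thesis by simp
  qed
  have iter: "norm (1 + ((4 / 3) ^ k) *\<^sub>R b) \<le> 1 \<and> norm (1 - ((4 / 3) ^ k) *\<^sub>R b) \<le> 1" for k
  proof (induction k)
    case (Suc k)
    define c where "c = ((4 / 3 :: real) ^ k) *\<^sub>R b"
    have "adj c = c" by (simp add: c_def adj_scaleR assms(1))
    then show ?case
      using expand[of c] expand[of "- c"] Suc by (simp add: c_def adj_minus)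
  qed (use assms in simp)
  have "norm b \<le> (3 / 4) ^ k" for k :: nat
  proof -
    let ?c = "((4 / 3 :: real) ^ k) *\<^sub>R b"
    have "2 * norm ?c = norm ((1 + ?c) - (1 - ?c))" by (simp flip: scaleR_2)
    also have "\<dots> \<le> 2" using norm_triangle_ineq4[of "1 + ?c" "1 - ?c"] iter[of k] by linarith
    finally show ?thesis by (simp add: power_divide field_simps)
  qed
  moreover have "(\<lambda>k. (3 / 4 :: real) ^ k) \<longlonglongrightarrow> 0" by (intro LIMSEQ_realpow_zero) auto
  ultimately have "norm b \<le> 0" by (intro LIMSEQ_le_const) auto
  then show ?thesis by simp
qed

lemma norm_complement_range_le:
  fixes v :: "'a::cstar_algebra"
  assumes "adj v * v = 1"
  shows "norm (1 - v * adj v) \<le> 1"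
proof -
  define q where "q = 1 - v * adj v"
  have "v * adj v * (v * adj v) = v * (adj v * v) * adj v" by (simp only: mult.assoc)
  then have "adj q * q = q" by (simp add: q_def assms adj_diff adj_mult adj_adj algebra_simps)
  then have "norm q * norm q = norm q" using cstar_identity[of q] by (simp add: power2_eq_square)
  then show ?thesis by (auto simp: q_def)
qed

text \<open>Compressing \<open>\<Sum>\<^sub>j s\<^sub>j s\<^sub>j\<^sup>* = 1\<close> by \<open>s\<^sub>i\<close> gives \<open>\<Sum>\<^sub>j\<^sub>\<noteq>\<^sub>i b\<^sub>j = 0\<close> for the positive contractions
  \<open>b\<^sub>j = s\<^sub>i\<^sup>* s\<^sub>j s\<^sub>j\<^sup>* s\<^sub>i\<close>, hence each of them vanishes.\<close>

lemma cuntz_family_orthogonal: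
  fixes s :: "nat \<Rightarrow> 'a::cstar_algebra"
  assumes iso: "\<And>j. j < d \<Longrightarrow> adj (s j) * s j = 1"
    and sum: "(\<Sum>j<d. s j * adj (s j)) = 1" and "i < d" "k < d" "i \<noteq> k"
  shows "adj (s k) * s i = 0"
proof -
  define b where "b j = adj (s i) * (s j * adj (s j)) * s i" for j
  have le: "norm (1 - b j) \<le> 1" if "j < d" for j
  proof -
    have "1 - b j = adj (s i) * ((1 - s j * adj (s j)) * s i)"
      by (simp add: b_def iso[OF \<open>i < d\<close>] algebra_simps)
    also have "norm \<dots> \<le> norm (adj (s i)) * (norm (1 - s j * adj (s j)) * norm (s i))"
      by (meson mult_left_mono norm_ge_zero norm_mult_ineq order_trans)
    finally show ?thesis
      using norm_complement_range_le[OF iso[OF that]] by (simp add: norm_isometry[OF iso[OF \<open>i < d\<close>]])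
  qed
  have "b i = 1"
  proof -
    have "b i = (adj (s i) * s i) * (adj (s i) * s i)" by (simp add: b_def mult.assoc)
    then show ?thesis by (simp add: iso[OF \<open>i < d\<close>])
  qed
  have "(\<Sum>j<d. b j) = adj (s i) * (\<Sum>j<d. s j * adj (s j)) * s i"
    by (simp add: b_def sum_distrib_left sum_distrib_right)
  also have "\<dots> = 1" by (simp add: sum iso[OF \<open>i < d\<close>])
  finally have "(\<Sum>j\<in>{..<d} - {i}. b j) = 0"
    using \<open>b i = 1\<close> \<open>i < d\<close> by (simp add: sum.remove[of "{..<d}" i b])
  moreover define J where "J = {..<d} - {i} - {k}"
  ultimately have "b k + (\<Sum>j\<in>J. b j) = 0"
    using assms(3-5) sum.remove[of "{..<d} - {i}" k b] by simp
  then have rest: "(\<Sum>j\<in>J. b j) = - b k" by (rule minus_unique[symmetric])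
  \<comment> \<open>Scaling by \<open>1/d\<close> turns \<open>\<parallel>1 - b\<^sub>j\<parallel> \<le> 1\<close> into the two bounds: the one for \<open>1 + b\<^sub>k/d\<close> because
    \<open>-b\<^sub>k\<close> is the sum of the remaining \<open>d - 2\<close> elements \<open>b\<^sub>j\<close>.\<close>
  have J: "card J + 2 = d" using assms(3-5) by (simp add: J_def)
  have "0 < real d" using \<open>i < d\<close> by simp
  have "norm (real d *\<^sub>R 1 - b k) \<le> real d"
  proof -
    have "real d *\<^sub>R 1 - b k = (real d - 1) *\<^sub>R 1 + (1 - b k)" by (simp add: algebra_simps)
    also have "norm \<dots> \<le> (real d - 1) + 1"
      using \<open>i < d\<close> le[OF \<open>k < d\<close>] by (intro norm_triangle_le add_mono) auto
    finally show ?thesis by simp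
  qed
  moreover have "norm (real d *\<^sub>R 1 + b k) \<le> real d"
  proof -
    have "real d *\<^sub>R 1 + b k = 2 *\<^sub>R 1 + (\<Sum>j\<in>J. 1 - b j)"
      by (simp add: rest sum_subtractf J[symmetric] scaleR_left_distrib scaleR_conv_of_real)
    also have "norm \<dots> \<le> 2 + (\<Sum>j\<in>J. 1)"
      using le by (intro norm_triangle_le add_mono sum_norm_le) (auto simp: J_def)
    also have "\<dots> = real d" by (simp add: J[symmetric])
    finally show ?thesis .
  qed
  moreover have "adj (b k) = b k" by (simp add: b_def adj_mult adj_adj mult.assoc)
  ultimately have "(1 / real d) *\<^sub>R b k = 0"
  proof (intro self_adjoint_eq_0I)
    have "1 + (1 / real d) *\<^sub>R b k = (1 / real d) *\<^sub>R (real d *\<^sub>R 1 + b k)"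
      "1 - (1 / real d) *\<^sub>R b k = (1 / real d) *\<^sub>R (real d *\<^sub>R 1 - b k)"
      using \<open>0 < real d\<close> by (simp_all add: scaleR_add_right scaleR_diff_right)
    moreover assume "norm (real d *\<^sub>R 1 + b k) \<le> real d" "norm (real d *\<^sub>R 1 - b k) \<le> real d"
    ultimately show "norm (1 + (1 / real d) *\<^sub>R b k) \<le> 1" "norm (1 - (1 / real d) *\<^sub>R b k) \<le> 1"
      using \<open>0 < real d\<close> by (simp_all only: norm_scaleR) (simp_all add: divide_simps)
  qed (simp add: adj_scaleR)
  then have "b k = 0" using \<open>0 < real d\<close> by simp
  moreover have "b k = adj (adj (s k) * s i) * (adj (s k) * s i)"
    by (simp add: b_def adj_mult adj_adj mult.assoc)
  ultimately have "(norm (adj (s k) * s i))\<^sup>2 = 0" by (metis cstar_identity norm_zero)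
  then show ?thesis by simp
qed


section \<open>A single generator\<close>

lemma cstar_subalgebra_hull: "cstar_subalgebra (cstar_generated G)"
  by (rule hull_in) (fastforce simp: cstar_subalgebra_def intro: closed_Inter)

locale isometry_partition =
  fixes N :: nat and m :: "nat \<Rightarrow> 'a::cstar_algebra"
  assumes m_orth: "\<lbrakk>i < N; k < N\<rbrakk> \<Longrightarrow> adj (m i) * m k = (if i = k then 1 else 0)"
    and m_sum: "(\<Sum>k<N. m k * adj (m k)) = 1"
begin

definition of_columns :: "(nat \<Rightarrow> 'a) \<Rightarrow> 'a" where
  "of_columns c = (\<Sum>k<N. c k * adj (m k))"

definition diag :: "(nat \<Rightarrow> real) \<Rightarrow> 'a" where
  "diag a = of_columns (\<lambda>k. a k *\<^sub>R m k)"

lemma of_columns_mult: "k < N \<Longrightarrow> of_columns c * m k = c k"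
  by (simp add: of_columns_def sum_distrib_right mult.assoc m_orth if_distrib[of "(*) _"] sum.delta'
      cong: if_cong)

lemma eq_of_columns: "x = of_columns (\<lambda>k. x * m k)"
  using m_sum by (simp add: of_columns_def mult.assoc flip: sum_distrib_left)

lemma of_columns_cong: "(\<And>k. k < N \<Longrightarrow> c k = c' k) \<Longrightarrow> of_columns c = of_columns c'"
  by (simp add: of_columns_def)

lemma of_columns_single: "k < N \<Longrightarrow> of_columns (\<lambda>l. if l = k then x else 0) = x * adj (m k)"
  by (simp add: of_columns_def if_distrib[of "\<lambda>u. u * _"] cong: if_cong)

lemma eq_by_columns: "(\<And>k. k < N \<Longrightarrow> x * m k = y * m k) \<Longrightarrow> x = y"
  by (metis eq_of_columns of_columns_cong)

lemma diag_mult_column: "k < N \<Longrightarrow> diag a * m k = a k *\<^sub>R m k"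
  by (simp add: diag_def of_columns_mult)

lemma adj_diag: "adj (diag a) = diag a"
  by (simp add: diag_def of_columns_def adj_sum adj_mult adj_adj adj_scaleR)

lemma diag_mult: "diag a * diag b = diag (\<lambda>k. a k * b k)"
  by (rule eq_by_columns) (simp add: diag_mult_column mult.assoc)

lemma diag_scaleR: "r *\<^sub>R diag a = diag (\<lambda>k. r * a k)"
  by (rule eq_by_columns) (simp add: diag_mult_column)

lemma diag_add: "diag a + diag b = diag (\<lambda>k. a k + b k)"
  by (rule eq_by_columns) (simp add: diag_mult_column distrib_right scaleR_left_distrib)

lemma diag_one: "diag (\<lambda>_. 1) = 1"
  by (rule eq_by_columns) (simp add: diag_mult_column)

lemma diag_cong: "(\<And>k. k < N \<Longrightarrow> a k = b k) \<Longrightarrow> diag a = diag b"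
  by (simp add: diag_def cong: of_columns_cong)

lemma square_of_orthogonal_columns:
  assumes "\<And>i k. \<lbrakk>i < N; k < N\<rbrakk> \<Longrightarrow> adj (c i) * c k = (if i = k then a k *\<^sub>R 1 else 0)"
  shows "adj (of_columns c) * of_columns c = diag a"
proof (rule eq_by_columns)
  fix k assume k: "k < N"
  have "adj (of_columns c) * of_columns c * m k = (\<Sum>i<N. m i * (adj (c i) * c k))"
    by (simp add: mult.assoc of_columns_mult k)
      (simp add: of_columns_def adj_sum adj_mult adj_adj sum_distrib_right mult.assoc)
  also have "\<dots> = a k *\<^sub>R m k"
    by (simp add: assms k if_distrib[of "(*) _"] cong: if_cong)
  finally show "adj (of_columns c) * of_columns c * m k = diag a * m k"
    by (simp add: diag_mult_column k)
qed

end

text \<open>The generator as a matrix over the blocks \<open>m\<^sub>0, \<dots>, m\<^sub>N\<^sub>-\<^sub>1\<close>: it is \<open>1\<close> at position \<open>(0,1)\<close>, then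
  \<open>1/2\<close> along the rest of the superdiagonal, and its last row carries \<open>s\<^sub>0/2, \<dots>, s\<^sub>d\<^sub>-\<^sub>1/2\<close> in the
  columns \<open>2, \<dots>, d+1\<close>.  The first two columns form the Jordan block that makes the disc minimal,
  the superdiagonal yields all matrix units and the last row yields the \<open>s\<^sub>j\<close>.  The columns are
  orthogonal to each other, so that the defect of the matrix is diagonal, and the norms of the other
  columns are less than 1, which separates the entry \<open>1\<close> from them.\<close>

locale shift_with_letters = isometry_partition N m
  for N :: nat and m :: "nat \<Rightarrow> 'a::cstar_algebra" +
  fixes d :: nat and s :: "nat \<Rightarrow> 'a"
  assumes s_orth: "\<lbrakk>i < d; k < d\<rbrakk> \<Longrightarrow> adj (s i) * s k = (if i = k then 1 else 0)"
    and d: "0 < d" and dN: "d + 2 \<le> N"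
begin

text \<open>The part of column \<open>k\<close> in the last row, up to the factor \<open>1/2\<close>.  It matters for \<open>k \<ge> 2\<close> only, so
  the truncated difference \<open>k - 2\<close> is the true one.\<close>

definition letter :: "nat \<Rightarrow> 'a" where
  "letter k = (if k < d + 2 then m (N - 1) * s (k - 2) else 0)"

definition column :: "nat \<Rightarrow> 'a" where
  "column k = (if k = 0 then 0 else if k = 1 then m 0 else (1 / 2) *\<^sub>R (m (k - 1) + letter k))"

definition gen :: 'a where
  "gen = of_columns column"

definition weight :: "nat \<Rightarrow> real" where
  "weight k = (if k = 0 then 0 else if k = 1 then 1 else if k < d + 2 then 1 / 2 else 1 / 4)"

lemma row_letter: "\<lbrakk>i < N - 1\<rbrakk> \<Longrightarrow> adj (m i) * letter k = 0"
  by (simp add: letter_def m_orth flip: mult.assoc)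

lemma column_orth:
  assumes "i < N" "k < N"
  shows "adj (column i) * column k = (if i = k then weight k *\<^sub>R 1 else 0)"
proof -
  have letters: "adj (letter i) * letter k = (if i = k \<and> k < d + 2 then 1 else 0)"
    if "2 \<le> i" "2 \<le> k" for i k
  proof -
    have "adj (m (N - 1)) * (m (N - 1) * z) = z" for z
      using d dN by (simp add: m_orth flip: mult.assoc)
    then show ?thesis using that
      by (auto simp: letter_def adj_mult mult.assoc s_orth)
  qed
  have mixed: "adj (letter i) * m l = 0" if "l < N - 1" for i l
    using arg_cong[OF row_letter[OF that], of adj] by (simp add: adj_mult adj_adj)
  have half: "adj (m (i - 1) + letter i) * (m (k - 1) + letter k)
      = (if i = k then 1 else 0) + (if i = k \<and> k < d + 2 then 1 else 0)"
    if "2 \<le> i" "i < N" "2 \<le> k" "k < N" for i k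
    using that by (simp add: adj_add distrib_left distrib_right letters mixed row_letter m_orth)
      auto
  have N0: "0 < N" "0 < N - 1" using d dN by auto
  have zero: "adj (m 0) * (m (k - 1) + letter k) = 0" if "2 \<le> k" "k < N" for k
    using that N0 by (simp add: distrib_left row_letter m_orth)
  have zero': "adj (m (k - 1) + letter k) * m 0 = 0" if "2 \<le> k" "k < N" for k
    using arg_cong[OF zero[OF that], of adj] by (simp add: adj_mult adj_adj)
  consider "i = 0 \<or> k = 0" | "i = 1" "k = 1" | "i = 1" "2 \<le> k" | "2 \<le> i" "k = 1" | "2 \<le> i" "2 \<le> k"
    by linarith
  then show ?thesis
  proof cases
    case 5
    then show ?thesis using half[of i k] assms
      by (auto simp: column_def weight_def adj_scaleR scaleR_2[symmetric])
  qed (use assms zero zero' N0 in \<open>auto simp: column_def weight_def adj_scaleR m_orth\<close>)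
qed

lemma gen_square: "adj gen * gen = diag weight"
  unfolding gen_def by (rule square_of_orthogonal_columns[OF column_orth])

lemma gen_defect:
  "adj gen * gen + adj (diag (\<lambda>k. sqrt (1 - weight k))) * diag (\<lambda>k. sqrt (1 - weight k)) = 1"
proof -
  have "weight k + sqrt (1 - weight k) * sqrt (1 - weight k) = 1" for k
    by (simp add: weight_def)
  then show ?thesis by (simp add: gen_square adj_diag diag_mult diag_add diag_one)
qed

lemma gen_column: "k < N \<Longrightarrow> gen * m k = column k"
  by (simp add: gen_def of_columns_mult)

lemma row_gen:
  assumes "1 \<le> i" "i < N - 1"
  shows "adj (m i) * gen = (1 / 2) *\<^sub>R adj (m (Suc i))"
proof (rule eq_by_columns)
  fix k assume k: "k < N"
  have "adj (m i) * column k = (if k = Suc i then (1 / 2) *\<^sub>R 1 else 0)"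
    using assms k by (auto simp: column_def distrib_left row_letter m_orth)
  then show "adj (m i) * gen * m k = (1 / 2) *\<^sub>R adj (m (Suc i)) * m k"
    using assms k by (simp add: mult.assoc gen_column m_orth)
qed

lemma last_row_gen:
  assumes "j < d"
  shows "adj (m (N - 1)) * gen * m (j + 2) = (1 / 2) *\<^sub>R s j"
proof -
  have "adj (m (N - 1)) * gen * m (j + 2) = (1 / 2) *\<^sub>R (adj (m (N - 1)) * m (j + 1) + adj (m (N - 1)) * letter (j + 2))"
    using assms dN by (simp add: mult.assoc gen_column column_def distrib_left)
  also have "adj (m (N - 1)) * m (j + 1) = 0" using assms dN by (subst m_orth) auto
  also have "adj (m (N - 1)) * letter (j + 2) = s j"
    using assms dN by (simp add: letter_def m_orth flip: mult.assoc)
  finally show ?thesis by simp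
qed

text \<open>The projection onto the block \<open>m\<^sub>1\<close> is a polynomial in \<open>T\<^sup>* T\<close>.  Multiplying by \<open>T\<close> moves it along the
  superdiagonal, which gives all matrix units; cutting out an entry of the last row then isolates
  a single \<open>s\<^sub>j\<close>.\<close>

lemma matrix_letter_in_generated:
  assumes "i < N" "l < N" "j < d"
  shows "m i * s j * adj (m l) \<in> cstar_generated {gen}"
proof -
  define A where "A = cstar_generated {gen}"
  have sub: "cstar_subalgebra A" unfolding A_def by (rule cstar_subalgebra_hull)
  have gen: "gen \<in> A" using hull_subset[of "{gen}" cstar_subalgebra] by (simp add: A_def)
  have mult: "x * y \<in> A" and add: "x + y \<in> A" if "x \<in> A" "y \<in> A" for x y
    using sub that by (auto simp: cstar_subalgebra_def)
  have adj: "adj x \<in> A" and scale: "r *\<^sub>R x \<in> A" if "x \<in> A" for x r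
    using sub that by (auto simp: cstar_subalgebra_def scaleR_scaleC)
  have N: "1 < N" using d dN by simp
  have corner: "m 1 * adj (m 1) \<in> A"
  proof -
    let ?P = "diag weight"
    have P: "?P \<in> A" using mult[OF adj[OF gen] gen] by (simp add: gen_square)
    \<comment> \<open>the polynomial \<open>(8/3) x (x - 1/2) (x - 1/4)\<close> takes the values \<open>0, 1, 0, 0\<close> at \<open>0, 1, 1/2, 1/4\<close>\<close>
    have "(8 / 3) *\<^sub>R (?P * (?P * ?P)) + ((- 2) *\<^sub>R (?P * ?P) + (1 / 3) *\<^sub>R ?P) \<in> A"
      by (intro add mult scale P)
    also have "(8 / 3) *\<^sub>R (?P * (?P * ?P)) + ((- 2) *\<^sub>R (?P * ?P) + (1 / 3) *\<^sub>R ?P)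
        = diag (\<lambda>k. if k = 1 then 1 else 0)"
      unfolding diag_mult diag_scaleR diag_add by (rule diag_cong) (simp add: weight_def)
    also have "\<dots> = of_columns (\<lambda>k. if k = 1 then m 1 else 0)"
      unfolding diag_def by (rule of_columns_cong) simp
    also have "\<dots> = m 1 * adj (m 1)" using N by (rule of_columns_single)
    finally show ?thesis .
  qed
  have chain: "m 1 * adj (m (Suc k)) \<in> A" if "Suc k < N" for k
    using that
  proof (induction k)
    case (Suc k)
    have "2 *\<^sub>R (m 1 * adj (m (Suc k)) * gen) = 2 *\<^sub>R (m 1 * ((1 / 2) *\<^sub>R adj (m (Suc (Suc k)))))"
      using row_gen[of "Suc k"] Suc.prems by (simp add: mult.assoc)
    also have "\<dots> = m 1 * adj (m (Suc (Suc k)))" by simp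
    finally show ?case using scale[OF mult[OF Suc.IH gen], of 2] Suc.prems by simp
  qed (use corner in simp)
  have first: "m 1 * adj (m k) \<in> A" if "k < N" for k
  proof (cases k)
    case 0
    have "gen * (m 1 * adj (m 1)) = m 0 * adj (m 1)"
      using gen_column[OF N] by (simp add: column_def flip: mult.assoc)
    then have "m 0 * adj (m 1) \<in> A" using mult[OF gen corner] by simp
    from adj[OF this] show ?thesis by (simp add: adj_mult adj_adj 0)
  qed (use chain that in simp)
  have unit: "m i * adj (m k) \<in> A" if "i < N" "k < N" for i k
  proof -
    have "adj (m 1 * adj (m i)) * (m 1 * adj (m k)) = m i * (adj (m 1) * m 1) * adj (m k)"
      by (simp add: adj_mult adj_adj mult.assoc)
    then show ?thesis using mult[OF adj[OF first[OF that(1)]] first[OF that(2)]] N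
      by (simp add: m_orth)
  qed
  have "(m i * adj (m (N - 1))) * gen * (m (j + 2) * adj (m l))
      = m i * (adj (m (N - 1)) * gen * m (j + 2)) * adj (m l)" by (simp add: mult.assoc)
  also have "\<dots> = (1 / 2) *\<^sub>R (m i * s j * adj (m l))"
    unfolding last_row_gen[OF \<open>j < d\<close>] by simp
  finally have "m i * s j * adj (m l) = 2 *\<^sub>R ((m i * adj (m (N - 1))) * gen * (m (j + 2) * adj (m l)))"
    by simp
  also have "\<dots> \<in> A" using assms N dN by (intro scale mult unit gen) auto
  finally show ?thesis by (simp add: A_def)
qed

end

text \<open>The blocks are the words of length two in the Cuntz isometries.  There are \<open>d\<^sup>2\<close> of them, which is
  at least \<open>d + 2\<close> for \<open>d \<ge> 2\<close>, and left multiplication by a letter takes a word to a word followed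
  by a letter: \<open>s\<^sub>l s\<^sub>i s\<^sub>j = (s\<^sub>l s\<^sub>i) s\<^sub>j\<close>.\<close>

theorem corollary2p4:
  fixes d :: nat and s :: "nat \<Rightarrow> 'a::cstar_algebra"
  assumes "d \<ge> 2"
    and "is_cuntz_algebra d s"
  shows "\<exists>T :: 'a. norm T \<le> 1 \<and> cstar_generated {T} = UNIV \<and> minimal_spectral_set (cball 0 1) T"
proof -
  from assms(2) have iso: "\<And>j. j < d \<Longrightarrow> adj (s j) * s j = 1"
    and sum: "(\<Sum>j<d. s j * adj (s j)) = 1"
    and generated: "cstar_generated (s ` {..<d}) = UNIV"
    by (auto simp: is_cuntz_algebra_def cuntz_family_type_cstar)
  have orth: "adj (s i) * s k = (if i = k then 1 else 0)" if "i < d" "k < d" for i k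
    using iso that cuntz_family_orthogonal[OF iso sum, of k i] by auto
  define m where "m n = s (n div d) * s (n mod d)" for n
  have lt: "n div d < d" "n mod d < d" if "n < d * d" for n
    using that assms(1) by (auto simp: less_mult_imp_div_less)
  have m_orth: "adj (m i) * m k = (if i = k then 1 else 0)" if "i < d * d" "k < d * d" for i k
  proof -
    have "adj (m i) * m k = adj (s (i mod d)) * (adj (s (i div d)) * s (k div d)) * s (k mod d)"
      by (simp add: m_def adj_mult mult.assoc)
    also have "\<dots> = (if i div d = k div d \<and> i mod d = k mod d then 1 else 0)"
      using lt that by (auto simp: orth)
    also have "(i div d = k div d \<and> i mod d = k mod d) = (i = k)" by (metis div_mult_mod_eq)
    finally show ?thesis .
  qed
  have word: "m (i * d + j) = s i * s j" if "j < d" for i j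
    using that by (simp add: m_def)
  have m_sum: "(\<Sum>k<d * d. m k * adj (m k)) = 1"
  proof -
    have "(\<Sum>k<d * d. m k * adj (m k)) = (\<Sum>i<d. \<Sum>k\<in>{i * d..<i * d + d}. m k * adj (m k))"
      by (rule sum.nat_group[symmetric])
    also have "\<dots> = (\<Sum>i<d. \<Sum>j<d. m (i * d + j) * adj (m (i * d + j)))"
    proof (rule sum.cong)
      fix i
      show "(\<Sum>k\<in>{i * d..<i * d + d}. m k * adj (m k)) = (\<Sum>j<d. m (i * d + j) * adj (m (i * d + j)))"
        using sum.shift_bounds_nat_ivl[of "\<lambda>k. m k * adj (m k)" 0 "i * d" d]
        by (simp add: add.commute lessThan_atLeast0)
    qed simp
    also have "\<dots> = (\<Sum>i<d. s i * (\<Sum>j<d. s j * adj (s j)) * adj (s i))"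
      by (simp add: word adj_mult sum_distrib_left sum_distrib_right mult.assoc)
    finally show ?thesis by (simp add: sum)
  qed
  have "d + 2 \<le> d * d"
  proof -
    have "2 * d \<le> d * d" using assms(1) by (rule mult_le_mono1)
    with assms(1) show ?thesis by linarith
  qed
  then interpret shift_with_letters "d * d" m d s
    using m_orth m_sum orth assms(1) by unfold_locales auto
  define A where "A = cstar_generated {gen}"
  have sub: "cstar_subalgebra A" unfolding A_def by (rule cstar_subalgebra_hull)
  have "s l \<in> A" if "l < d" for l
  proof -
    have summand: "s l * (m k * adj (m k)) \<in> A" if k: "k < d * d" for k
    proof -
      have "l * d + k div d < d * d"
      proof -
        have "l * d + k div d < Suc l * d" using lt(1)[OF k] by simp
        also have "\<dots> \<le> d * d" using \<open>l < d\<close> by (intro mult_le_mono1) simp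
        finally show ?thesis .
      qed
      moreover have "s l * (m k * adj (m k)) = m (l * d + k div d) * s (k mod d) * adj (m k)"
        unfolding word[OF lt(1)[OF k]] by (simp add: m_def mult.assoc)
      ultimately show ?thesis using matrix_letter_in_generated k lt(2)[OF k] by (simp add: A_def)
    qed
    have "(\<Sum>k\<in>K. s l * (m k * adj (m k))) \<in> A" if "K \<subseteq> {..<d * d}" for K
      using finite_subset[OF that finite_lessThan] that
    proof (induction K rule: finite_induct)
      case empty
      then show ?case using sub by (simp add: cstar_subalgebra_def)
    next
      case (insert k K)
      then show ?case using sub summand[of k]
        by (simp add: cstar_subalgebra_def)
    qed
    then have "s l * (\<Sum>k<d * d. m k * adj (m k)) \<in> A"
      by (simp add: sum_distrib_left)
    then show ?thesis by (simp add: m_sum)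
  qed
  then have "cstar_generated (s ` {..<d}) \<subseteq> A"
    by (intro hull_minimal sub) auto
  then have gen: "cstar_generated {gen} = UNIV" using generated by (auto simp: A_def)
  have vN: "norm (poly_at f gen) \<le> S" if "\<And>z. cmod z \<le> 1 \<Longrightarrow> cmod (poly f z) \<le> S" for f S
    using assms(1) that
    by (intro von_neumann_defect[where u = "s 0" and w = "s 1", OF _ _ _ gen_defect])
      (auto simp: orth)
  have "norm gen \<le> 1"
    using vN[of "[:0, 1:]" 1] by (simp add: poly_at_pCons scaleC_one)
  moreover have "minimal_spectral_set (cball 0 1) gen"
  proof (rule minimal_spectral_set_disc)
    show "spectral_set (cball 0 1) gen" by (rule spectral_set_disc) (rule vN)
    have "0 < d * d" "1 < d * d" using \<open>d + 2 \<le> d * d\<close> by linarith+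
    then show "adj (m 1) * m 1 = 1" "adj (m 0) * m 0 = 1" "gen * m 1 = m 0" "gen * m 0 = 0"
      by (auto simp: m_orth gen_column column_def)
  qed
  ultimately show ?thesis using gen by blast
qed

end
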